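(* Let $K$ be a commutative ring with unit, $X$ a set, $\Omega=\bigcup_{t\ge 1}\Omega_t$ a set of operator symbols ($\Omega_t$ the $t$-ary ones), $>$ a monomial order on $\mathcal{Q}(X)$, and $S$ a set of monic commutative $\Omega$-polynomials in $K[X;\Omega]$. Then the following statements are equivalent: (I) $S$ is a Gröbner-Shirshov basis in $K[X;\Omega]$. (II) For every nonzero $f\in Id(S)$, $\bar f=u|_{\overline{s}}$ for some $u\in\mathcal{Q}^\star(X)$ and $s\in S$. (III) The set $Irr(S)=\{w\in\mathcal{Q}(X)\mid w\neq u|_{\overline{s}}\text{ for all }u\in\mathcal{Q}^\star(X)\text{ and }s\in S\}$ is a $K$-basis of $K[X;\Omega|S]=K[X;\Omega]/Id(S)$ (that is, the images of the elements of $Irr(S)$ form a $K$-basis).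
   Context: Algebras are associative and not necessarily unital. For a set $Y$, $CS(Y)$ is the free commutative semigroup on $Y$ (nonempty commutative words). Commutative $\Omega$-words: put $\mathcal{Q}_0=CS(X)$ and, for $n\ge 1$, $\Gamma_n=X\cup\Omega(\mathcal{Q}_{n-1})$, $\mathcal{Q}_n=CS(\Gamma_n)$, where $\Omega(\mathcal{Q}_{n-1})=\bigcup_{t\ge1}\{\theta(u_1,\dots,u_t)\mid\theta\in\Omega_t,\ u_i\in\mathcal{Q}_{n-1}\}$ (formal expressions). Then $\mathcal{Q}(X)=\bigcup_{n\ge0}\mathcal{Q}_n$ is a commutative semigroup; its elements are called commutative $\Omega$-words. Each $u\in\mathcal{Q}(X)$ is uniquely (up to order of factors) a product $u_1\cdots u_n$ with $n\ge1$ and $u_i\in X\cup\Omega(\mathcal{Q}(X))$; put $bre(u)=n$. $K[X;\Omega]$ is the commutative $K$-algebra with $K$-basis $\mathcal{Q}(X)$, each $\theta\in\Omega_t$ being extended multilinearly to $K[X;\Omega]^t\to K[X;\Omega]$; its elements are called commutative $\Omega$-polynomials. $\mathcal{Q}^\star(X)$ is the set of elements of $\mathcal{Q}(X\cup\{\star\})$, $\star\notin X$, in which $\star$ occurs exactly once. For $u\in\mathcal{Q}^\star(X)$ and $s\in K[X;\Omega]$, $u|_s$ is the element of $K[X;\Omega]$ obtained by replacing $\star$ by $s$ in $u$. A monomial order on $\mathcal{Q}(X)$ is a well order $>$ such that $w>v$ implies $u|_w>u|_v$ for all $w,v\in\mathcal{Q}(X)$, $u\in\mathcal{Q}^\star(X)$.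 For nonzero $f\in K[X;\Omega]$, $\bar f$ is the largest commutative $\Omega$-word occurring in $f$ with nonzero coefficient; $f$ is monic if the coefficient of $\bar f$ is $1$. Compositions of monic $f,g$: (i) if $w=a\bar f=b\bar g$ for some $a,b\in\mathcal{Q}(X)$ with $bre(w)<bre(\bar f)+bre(\bar g)$, then $(f,g)_w=af-bg$ (intersection composition); (ii) if $w=\bar f=u|_{\bar g}$ for some $u\in\mathcal{Q}^\star(X)$, then $(f,g)_w=f-u|_g$ (including composition). For a set $S$ of monic commutative $\Omega$-polynomials, $(f,g)_w$ is trivial modulo $(S,w)$ if $(f,g)_w=\sum_i\alpha_iu_i|_{s_i}$ (finite sum) with $\alpha_i\in K$, $u_i\in\mathcal{Q}^\star(X)$, $s_i\in S$ and $u_i|_{\overline{s_i}}<w$ for all $i$. $S$ is a Gröbner-Shirshov basis in $K[X;\Omega]$ if every composition $(f,g)_w$ with $f,g\in S$ is trivial modulo $(S,w)$. $Id(S)$ is the ideal of $K[X;\Omega]$, as an algebra with operators, generated by $S$; it is the $K$-span of all $u|_s$ with $u\in\mathcal{Q}^\star(X)$, $s\in S$. *)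

theory Defs
  imports "HOL-Library.Poly_Mapping" "HOL-Library.Multiset" "HOL-Algebra.Module"
begin

section \<open>Commutative words with operators\<close>

text \<open>
  A commutative word is the multiset of its factors, so the product of words is multiset union
  \<open>+\<close> and the empty multiset is not a word.  The datatype contains all formal expressions;
  \<open>cwords X Om\<close> below singles out the actual words over \<open>X\<close> and \<open>Om\<close>, where \<open>Om t\<close> is the set
  of \<open>t\<close>-ary operator symbols (\<open>Om 0\<close> is never used).
\<close>

datatype ('x, 'o) factor = Var 'x | Op 'o "('x, 'o) factor multiset list"

type_synonym ('x, 'o) cword = "('x, 'o) factor multiset"

definition CS :: "'a set \<Rightarrow> 'a multiset set" where
  "CS Y = {w. w \<noteq> {#} \<and> set_mset w \<subseteq> Y}"

definition op_exprs :: "(nat \<Rightarrow> 'o set) \<Rightarrow> ('x, 'o) cword set \<Rightarrow> ('x, 'o) factor set" where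
  "op_exprs Om W = {Op \<theta> us | \<theta> us. length us \<ge> 1 \<and> \<theta> \<in> Om (length us) \<and> set us \<subseteq> W}"

primrec cwords_upto :: "'x set \<Rightarrow> (nat \<Rightarrow> 'o set) \<Rightarrow> nat \<Rightarrow> ('x, 'o) cword set" where
  "cwords_upto X Om 0 = CS (Var ` X)"
| "cwords_upto X Om (Suc n) = CS (Var ` X \<union> op_exprs Om (cwords_upto X Om n))"

definition cwords :: "'x set \<Rightarrow> (nat \<Rightarrow> 'o set) \<Rightarrow> ('x, 'o) cword set" where
  "cwords X Om = (\<Union>n. cwords_upto X Om n)"

definition bre :: "('x, 'o) cword \<Rightarrow> nat" where
  "bre u = size u"


section \<open>Commutative polynomials with operators\<close>

text \<open>
  The library multiplication on \<open>cword \<Rightarrow>\<^sub>0 'k\<close> extends multiset union bilinearly.  The whole type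
  has the unit \<open>single {#} 1\<close>, which does not belong to the non-unital algebra \<open>cpolys X Om\<close>.
\<close>

type_synonym ('x, 'o, 'k) cpoly = "('x, 'o) cword \<Rightarrow>\<^sub>0 'k"

definition cpolys :: "'x set \<Rightarrow> (nat \<Rightarrow> 'o set) \<Rightarrow> ('x, 'o, 'k::comm_ring_1) cpoly set" where
  "cpolys X Om = {f. Poly_Mapping.keys f \<subseteq> cwords X Om}"

abbreviation word_poly :: "('x, 'o) cword \<Rightarrow> ('x, 'o, 'k::comm_ring_1) cpoly" where
  "word_poly w \<equiv> Poly_Mapping.single w 1"

definition scale :: "'k::comm_ring_1 \<Rightarrow> ('x, 'o, 'k) cpoly \<Rightarrow> ('x, 'o, 'k) cpoly" where
  "scale c f = Poly_Mapping.map ((*) c) f"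

text \<open>The multilinear extension of an operator symbol.\<close>

definition op_ext :: "'o \<Rightarrow> ('x, 'o, 'k::comm_ring_1) cpoly list \<Rightarrow> ('x, 'o, 'k) cpoly" where
  "op_ext \<theta> fs =
     (\<Sum>ws\<in>listset (map Poly_Mapping.keys fs).
        Poly_Mapping.single {#Op \<theta> ws#} (\<Prod>i<length fs. Poly_Mapping.lookup (fs ! i) (ws ! i)))"


section \<open>Words with one hole\<close>

text \<open>The set \<open>X \<union> {\<star>}\<close> is rendered as \<open>insert None (Some ` X)\<close>, with \<open>None\<close> for \<open>\<star>\<close>.\<close>

primrec holes :: "('x option, 'o) factor \<Rightarrow> nat" where
  "holes (Var y) = (case y of None \<Rightarrow> 1 | Some x \<Rightarrow> 0)"
| "holes (Op \<theta> us) = sum_list (map sum_mset (map (image_mset holes) us))"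

definition star_words :: "'x set \<Rightarrow> (nat \<Rightarrow> 'o set) \<Rightarrow> ('x option, 'o) cword set" where
  "star_words X Om =
     {u \<in> cwords (insert None (Some ` X)) Om. \<Sum>\<^sub># (image_mset holes u) = 1}"

primrec plug_word_factor ::
    "('x, 'o) cword \<Rightarrow> ('x option, 'o) factor \<Rightarrow> ('x, 'o) cword" where
  "plug_word_factor v (Var y) = (case y of None \<Rightarrow> v | Some x \<Rightarrow> {#Var x#})"
| "plug_word_factor v (Op \<theta> us) =
     {#Op \<theta> (map sum_mset (map (image_mset (plug_word_factor v)) us))#}"

definition plug_word :: "('x option, 'o) cword \<Rightarrow> ('x, 'o) cword \<Rightarrow> ('x, 'o) cword" where
  "plug_word u v = \<Sum>\<^sub># (image_mset (plug_word_factor v) u)"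

primrec plug_factor ::
    "('x, 'o, 'k::comm_ring_1) cpoly \<Rightarrow> ('x option, 'o) factor \<Rightarrow> ('x, 'o, 'k) cpoly" where
  "plug_factor s (Var y) = (case y of None \<Rightarrow> s | Some x \<Rightarrow> word_poly {#Var x#})"
| "plug_factor s (Op \<theta> us) =
     op_ext \<theta> (map prod_mset (map (image_mset (plug_factor s)) us))"

definition plug ::
    "('x option, 'o) cword \<Rightarrow> ('x, 'o, 'k::comm_ring_1) cpoly \<Rightarrow> ('x, 'o, 'k) cpoly" where
  "plug u s = \<Prod>\<^sub># (image_mset (plug_factor s) u)"


section \<open>Monomial orders and leading words\<close>

text \<open>
  A well order is given, as in the library, by its reflexive relation: \<open>(v, w) \<in> r\<close> means
  \<open>v \<le> w\<close>.
\<close>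

definition monomial_order ::
    "'x set \<Rightarrow> (nat \<Rightarrow> 'o set) \<Rightarrow> (('x, 'o) cword \<times> ('x, 'o) cword) set \<Rightarrow> bool" where
  "monomial_order X Om r \<longleftrightarrow>
     well_order_on (cwords X Om) r \<and>
     (\<forall>w\<in>cwords X Om. \<forall>v\<in>cwords X Om. \<forall>u\<in>star_words X Om.
        (v, w) \<in> r - Id \<longrightarrow> (plug_word u v, plug_word u w) \<in> r - Id)"

definition lead_word ::
    "(('x, 'o) cword \<times> ('x, 'o) cword) set \<Rightarrow> ('x, 'o, 'k::comm_ring_1) cpoly \<Rightarrow> ('x, 'o) cword" where
  "lead_word r f =
     (THE w. w \<in> Poly_Mapping.keys f \<and> (\<forall>v\<in>Poly_Mapping.keys f. (v, w) \<in> r))"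

definition monic ::
    "(('x, 'o) cword \<times> ('x, 'o) cword) set \<Rightarrow> ('x, 'o, 'k::comm_ring_1) cpoly \<Rightarrow> bool" where
  "monic r f \<longleftrightarrow> f \<noteq> 0 \<and> Poly_Mapping.lookup f (lead_word r f) = 1"


section \<open>Compositions and Groebner-Shirshov bases\<close>

text \<open>\<open>is_composition X Om r f g w h\<close>: \<open>h\<close> is a composition of \<open>f\<close> and \<open>g\<close> with ambiguity \<open>w\<close>.\<close>

inductive is_composition ::
    "'x set \<Rightarrow> (nat \<Rightarrow> 'o set) \<Rightarrow> (('x, 'o) cword \<times> ('x, 'o) cword) set \<Rightarrow>
     ('x, 'o, 'k::comm_ring_1) cpoly \<Rightarrow> ('x, 'o, 'k) cpoly \<Rightarrow>
     ('x, 'o) cword \<Rightarrow> ('x, 'o, 'k) cpoly \<Rightarrow> bool"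
  for X Om r f g where
  intersection:
    "\<lbrakk>a \<in> cwords X Om; b \<in> cwords X Om; w = a + lead_word r f; w = b + lead_word r g;
      bre w < bre (lead_word r f) + bre (lead_word r g)\<rbrakk>
     \<Longrightarrow> is_composition X Om r f g w (word_poly a * f - word_poly b * g)"
| inclusion:
    "\<lbrakk>u \<in> star_words X Om; w = lead_word r f; w = plug_word u (lead_word r g)\<rbrakk>
     \<Longrightarrow> is_composition X Om r f g w (f - plug u g)"

definition trivial_mod ::
    "'x set \<Rightarrow> (nat \<Rightarrow> 'o set) \<Rightarrow> (('x, 'o) cword \<times> ('x, 'o) cword) set \<Rightarrow>
     ('x, 'o, 'k::comm_ring_1) cpoly set \<Rightarrow> ('x, 'o) cword \<Rightarrow> ('x, 'o, 'k) cpoly \<Rightarrow> bool" where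
  "trivial_mod X Om r S w h \<longleftrightarrow>
     (\<exists>ts. (\<forall>(\<alpha>, u, s)\<in>set ts. u \<in> star_words X Om \<and> s \<in> S \<and>
                               (plug_word u (lead_word r s), w) \<in> r - Id) \<and>
           h = (\<Sum>(\<alpha>, u, s)\<leftarrow>ts. scale \<alpha> (plug u s)))"

definition groebner_shirshov_basis ::
    "'x set \<Rightarrow> (nat \<Rightarrow> 'o set) \<Rightarrow> (('x, 'o) cword \<times> ('x, 'o) cword) set \<Rightarrow>
     ('x, 'o, 'k::comm_ring_1) cpoly set \<Rightarrow> bool" where
  "groebner_shirshov_basis X Om r S \<longleftrightarrow>
     (\<forall>f\<in>S. \<forall>g\<in>S. \<forall>w h. is_composition X Om r f g w h \<longrightarrow> trivial_mod X Om r S w h)"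

definition Irr ::
    "'x set \<Rightarrow> (nat \<Rightarrow> 'o set) \<Rightarrow> (('x, 'o) cword \<times> ('x, 'o) cword) set \<Rightarrow>
     ('x, 'o, 'k::comm_ring_1) cpoly set \<Rightarrow> ('x, 'o) cword set" where
  "Irr X Om r S =
     {w \<in> cwords X Om. \<forall>u\<in>star_words X Om. \<forall>s\<in>S. w \<noteq> plug_word u (lead_word r s)}"


section \<open>Ideals and quotients\<close>

text \<open>
  Since the operators are multilinear, an ideal of an algebra with operators has to absorb the
  operators in each argument: \<open>\<theta>(f\<^sub>1, \<dots>, f\<^sub>t)\<close> lies in the ideal as soon as one \<open>f\<^sub>i\<close> does.
\<close>

definition operator_ideal ::
    "'x set \<Rightarrow> (nat \<Rightarrow> 'o set) \<Rightarrow> ('x, 'o, 'k::comm_ring_1) cpoly set \<Rightarrow> bool" where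
  "operator_ideal X Om I \<longleftrightarrow>
     I \<subseteq> cpolys X Om \<and> 0 \<in> I \<and>
     (\<forall>f\<in>I. \<forall>g\<in>I. f + g \<in> I) \<and>
     (\<forall>c. \<forall>f\<in>I. scale c f \<in> I) \<and>
     (\<forall>f\<in>I. \<forall>g\<in>cpolys X Om. g * f \<in> I) \<and>
     (\<forall>fs \<theta>. length fs \<ge> 1 \<and> \<theta> \<in> Om (length fs) \<and> set fs \<subseteq> cpolys X Om \<and> set fs \<inter> I \<noteq> {}
        \<longrightarrow> op_ext \<theta> fs \<in> I)"

definition Id_gen ::
    "'x set \<Rightarrow> (nat \<Rightarrow> 'o set) \<Rightarrow> ('x, 'o, 'k::comm_ring_1) cpoly set \<Rightarrow> ('x, 'o, 'k) cpoly set" where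
  "Id_gen X Om S = \<Inter>{I. operator_ideal X Om I \<and> S \<subseteq> I}"

definition residue_class ::
    "'x set \<Rightarrow> (nat \<Rightarrow> 'o set) \<Rightarrow> ('x, 'o, 'k::comm_ring_1) cpoly set \<Rightarrow>
     ('x, 'o, 'k) cpoly \<Rightarrow> ('x, 'o, 'k) cpoly set" where
  "residue_class X Om S f = {g \<in> cpolys X Om. g - f \<in> Id_gen X Om S}"

text \<open>
  The quotient of \<open>cpolys X Om\<close> by \<open>Id_gen X Om S\<close>; its elements are residue classes and its
  operations are computed on representatives.  The algebra need not be unital, so the field
  \<open>one\<close> of the record carries no information.
\<close>

definition quotient_algebra ::
    "'x set \<Rightarrow> (nat \<Rightarrow> 'o set) \<Rightarrow> ('x, 'o, 'k::comm_ring_1) cpoly set \<Rightarrow>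
     ('k, ('x, 'o, 'k) cpoly set) module" where
  "quotient_algebra X Om S =
     \<lparr>carrier = residue_class X Om S ` cpolys X Om,
      mult = (\<lambda>A B. \<Union>f\<in>A. \<Union>g\<in>B. residue_class X Om S (f * g)),
      one = undefined,
      zero = residue_class X Om S 0,
      add = (\<lambda>A B. \<Union>f\<in>A. \<Union>g\<in>B. residue_class X Om S (f + g)),
      smult = (\<lambda>c A. \<Union>f\<in>A. residue_class X Om S (scale c f))\<rparr>"

text \<open>
  A family \<open>b\<close> indexed by \<open>J\<close> is a basis if it generates the module and is linearly independent.
  Independence is that of the family, so it forces \<open>b\<close> to be injective on \<open>J\<close>.
\<close>

definition lin_comb :: "('k::comm_ring_1, 'm) module \<Rightarrow> ('i \<Rightarrow> 'm) \<Rightarrow> ('i \<Rightarrow>\<^sub>0 'k) \<Rightarrow> 'm" where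
  "lin_comb M b c =
     finsum M (\<lambda>i. Poly_Mapping.lookup c i \<odot>\<^bsub>M\<^esub> b i) (Poly_Mapping.keys c)"

definition is_module_basis :: "('k::comm_ring_1, 'm) module \<Rightarrow> 'i set \<Rightarrow> ('i \<Rightarrow> 'm) \<Rightarrow> bool" where
  "is_module_basis M J b \<longleftrightarrow>
     b ` J \<subseteq> carrier M \<and>
     (\<forall>m\<in>carrier M. \<exists>c. Poly_Mapping.keys c \<subseteq> J \<and> m = lin_comb M b c) \<and>
     (\<forall>c. Poly_Mapping.keys c \<subseteq> J \<and> lin_comb M b c = \<zero>\<^bsub>M\<^esub> \<longrightarrow> c = 0)"

end

theory Submission
  imports Defs "HOL.Modules"
begin

text \<open>
  A word with one hole acts on words and, linearly extended, on polynomials, so \<open>u|\<^sub>w\<close> and \<open>u|\<^sub>s\<close> are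
  governed by a single map between words, a context.  If \<open>\<phi>(lead f) = \<psi>(lead g) = w\<close> for contexts
  \<open>\<phi>\<close> and \<open>\<psi>\<close>, the two occurrences are disjoint, nested, or overlapping products of factors of the
  same subword; in the last two cases a composition occurs inside a context, so for a
  Groebner-Shirshov basis \<open>\<phi>(f) - \<psi>(g)\<close> is always a combination of instances of \<open>S\<close> below \<open>w\<close>.
  Well-founded induction on the largest leading word used to write \<open>f \<in> Id(S)\<close> then shows that the
  leading word of \<open>f\<close> is reducible.  Hence the ideal meets the span of \<open>Irr(S)\<close> only in \<open>0\<close>.
  As every polynomial reduces to a combination of irreducible words without using instances above
  its leading word, this trivial intersection amounts to the basis property of \<open>Irr(S)\<close>,
  and it makes the reduction of each composition end in \<open>0\<close>.
\<close>

section \<open>Linear extension of maps between words\<close>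

lemma lookup_scale: "Poly_Mapping.lookup (scale c f) w = c * Poly_Mapping.lookup f w"
  unfolding scale_def by transfer (simp add: when_def)

text \<open>Makes spans and subspaces over an arbitrary commutative coefficient ring available. The
  ambient module is the whole type, so the unit \<open>word_poly {#}\<close> belongs to it.\<close>

interpretation poly: Modules.module "scale :: 'k::comm_ring_1 \<Rightarrow> ('x, 'o, 'k) cpoly \<Rightarrow> _"
  by unfold_locales
    (rule poly_mapping_eqI, simp add: lookup_scale lookup_add algebra_simps)+

lemma scale_single: "scale c (Poly_Mapping.single w d) = Poly_Mapping.single w (c * d)"
  by (rule poly_mapping_eqI) (simp add: lookup_scale lookup_single when_def)

lemma keys_scale_subset: "Poly_Mapping.keys (scale c f) \<subseteq> Poly_Mapping.keys f"
  by (auto simp: in_keys_iff lookup_scale)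

lemma poly_expansion:
  assumes "finite A" "Poly_Mapping.keys f \<subseteq> A"
  shows "f = (\<Sum>w\<in>A. Poly_Mapping.single w (Poly_Mapping.lookup f w))"
proof (rule poly_mapping_eqI)
  fix v
  have "Poly_Mapping.lookup (\<Sum>w\<in>A. Poly_Mapping.single w (Poly_Mapping.lookup f w)) v =
      (\<Sum>w\<in>A. if w = v then Poly_Mapping.lookup f w else 0)"
    by (simp add: lookup_sum lookup_single when_def)
  also have "\<dots> = Poly_Mapping.lookup f v"
    using assms by (auto simp: in_keys_iff)
  finally show "Poly_Mapping.lookup f v =
      Poly_Mapping.lookup (\<Sum>w\<in>A. Poly_Mapping.single w (Poly_Mapping.lookup f w)) v" by simp
qed

text \<open>The map \<open>\<phi>\<close> may identify words, so coefficients are summed rather than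
  transported. All substitutions of polynomials into words are brought to this form.\<close>

definition linext ::
    "(('x, 'o) cword \<Rightarrow> ('x, 'o) cword) \<Rightarrow> ('x, 'o, 'k::comm_ring_1) cpoly \<Rightarrow> ('x, 'o, 'k) cpoly" where
  "linext \<phi> f = (\<Sum>w\<in>Poly_Mapping.keys f. Poly_Mapping.single (\<phi> w) (Poly_Mapping.lookup f w))"

text \<open>Words outside the support contribute zero, so several polynomials can be expanded over
  one index set. Additivity needs this, because terms may cancel in a sum.\<close>

lemma linext_eq_sum:
  assumes "finite A" "Poly_Mapping.keys f \<subseteq> A"
  shows "linext \<phi> f = (\<Sum>w\<in>A. Poly_Mapping.single (\<phi> w) (Poly_Mapping.lookup f w))"
  unfolding linext_def
  by (rule sum.mono_neutral_left) (use assms in \<open>auto simp: in_keys_iff\<close>)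

lemma linext_single [simp]: "linext \<phi> (Poly_Mapping.single w c) = Poly_Mapping.single (\<phi> w) c"
  by (subst linext_eq_sum[of "{w}"]) auto

lemma linext_zero [simp]: "linext \<phi> 0 = 0"
  by (simp add: linext_def)

lemma linext_add: "linext \<phi> (f + g) = linext \<phi> f + linext \<phi> g"
proof -
  let ?A = "Poly_Mapping.keys f \<union> Poly_Mapping.keys g"
  have "linext \<phi> h = (\<Sum>w\<in>?A. Poly_Mapping.single (\<phi> w) (Poly_Mapping.lookup h w))"
    if "Poly_Mapping.keys h \<subseteq> ?A" for h :: "('a, 'b, 'c) cpoly"
    by (rule linext_eq_sum) (use that in auto)
  then show ?thesis
    using keys_add[of f g] by (simp add: lookup_add single_add sum.distrib)
qed

lemma linext_scale: "linext \<phi> (scale c f) = scale c (linext \<phi> f)"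
proof -
  have "linext \<phi> (scale c f) =
      (\<Sum>w\<in>Poly_Mapping.keys f. Poly_Mapping.single (\<phi> w) (Poly_Mapping.lookup (scale c f) w))"
    by (rule linext_eq_sum) (simp_all add: keys_scale_subset)
  then show ?thesis
    by (simp add: linext_def lookup_scale scale_single poly.scale_sum_right)
qed

lemma linext_sum: "linext \<phi> (sum h A) = (\<Sum>i\<in>A. linext \<phi> (h i))"
  by (induction A rule: infinite_finite_induct) (simp_all add: linext_add)

lemma linext_uminus: "linext \<phi> (- f) = - linext \<phi> f"
  using linext_add[of \<phi> f "- f"] by (simp add: eq_neg_iff_add_eq_0 add.commute)

lemma linext_diff: "linext \<phi> (f - g) = linext \<phi> f - linext \<phi> g"
  using linext_add[of \<phi> f "- g"] by (simp add: linext_uminus)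

lemma linext_linext: "linext \<phi> (linext \<psi> f) = linext (\<lambda>w. \<phi> (\<psi> w)) f"
  by (simp add: linext_def[of \<psi>] linext_def[of "\<lambda>w. \<phi> (\<psi> w)"] linext_sum)

lemma linext_id [simp]: "linext (\<lambda>w. w) f = f"
  unfolding linext_def by (rule poly_expansion[symmetric]) simp_all

lemma single_mult_eq: "Poly_Mapping.single v c * f = scale c (linext ((+) v) f)"
proof -
  have "Poly_Mapping.single v c * f =
      Poly_Mapping.single v c * (\<Sum>w\<in>Poly_Mapping.keys f. Poly_Mapping.single w (Poly_Mapping.lookup f w))"
    by (subst poly_expansion[symmetric]) simp_all
  then show ?thesis
    by (simp add: linext_def sum_distrib_left mult_single scale_single poly.scale_sum_right)
qed

text \<open>Multiplying by a word is a linear extension, so closure under products reduces to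
  closure under the maps \<open>(+) v\<close>.\<close>

lemma mult_eq_sum_linext:
  "g * f = (\<Sum>v\<in>Poly_Mapping.keys g. scale (Poly_Mapping.lookup g v) (linext ((+) v) f))"
proof -
  have "g * f = (\<Sum>v\<in>Poly_Mapping.keys g. Poly_Mapping.single v (Poly_Mapping.lookup g v)) * f"
    by (subst poly_expansion[symmetric]) simp_all
  then show ?thesis
    by (simp add: sum_distrib_right single_mult_eq)
qed

lemma keys_linext_subset: "Poly_Mapping.keys (linext \<phi> f) \<subseteq> \<phi> ` Poly_Mapping.keys f"
proof -
  have "Poly_Mapping.keys (linext \<phi> f) \<subseteq>
      (\<Union>w\<in>Poly_Mapping.keys f. Poly_Mapping.keys (Poly_Mapping.single (\<phi> w) (Poly_Mapping.lookup f w)))"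
    unfolding linext_def by (rule keys_sum)
  also have "\<dots> \<subseteq> \<phi> ` Poly_Mapping.keys f"
    by auto
  finally show ?thesis .
qed

text \<open>Injectivity is asked for only at \<open>v\<close>: this is what a strictly monotone map
  provides at a leading word.\<close>

lemma lookup_linext_inj:
  assumes "\<And>w. w \<in> Poly_Mapping.keys f \<Longrightarrow> \<phi> w = \<phi> v \<Longrightarrow> w = v"
  shows "Poly_Mapping.lookup (linext \<phi> f) (\<phi> v) = Poly_Mapping.lookup f v"
proof -
  have "Poly_Mapping.lookup (linext \<phi> f) (\<phi> v) =
      (\<Sum>w\<in>Poly_Mapping.keys f. if w = v then Poly_Mapping.lookup f w else 0)"
    unfolding linext_def lookup_sum
    by (rule sum.cong) (use assms in \<open>auto simp: lookup_single when_def\<close>)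
  then show ?thesis
    by (auto simp: in_keys_iff)
qed

section \<open>Multilinearity of the operator symbols\<close>

lemma in_listset_iff:
  "ws \<in> listset As \<longleftrightarrow> length ws = length As \<and> (\<forall>i<length As. ws ! i \<in> As ! i)"
proof (induction As arbitrary: ws)
  case Nil
  then show ?case by auto
next
  case (Cons A As)
  show ?case
    by (cases ws) (auto simp: set_Cons_def Cons.IH All_less_Suc2)
qed

text \<open>
  Isolates the dependence of \<open>op_ext \<theta> fs\<close> on its \<open>i\<close>-th argument; the entry \<open>{#}\<close> at
  position \<open>i\<close> of \<open>ws\<close> is a placeholder.
\<close>

lemma op_ext_eq_sum_linext:
  assumes i: "i < length fs"
  shows "op_ext \<theta> fs =
    (\<Sum>ws\<in>listset ((map Poly_Mapping.keys fs)[i := {{#}}]).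
       scale (\<Prod>j\<in>{..<length fs} - {i}. Poly_Mapping.lookup (fs ! j) (ws ! j))
         (linext (\<lambda>w. {#Op \<theta> (ws[i := w])#}) (fs ! i)))"
proof -
  let ?L = "listset (map Poly_Mapping.keys fs)"
  let ?M = "listset ((map Poly_Mapping.keys fs)[i := {{#}}])"
  let ?c = "\<lambda>ws. \<Prod>j\<in>{..<length fs} - {i}. Poly_Mapping.lookup (fs ! j) (ws ! j)"
  have L_iff: "ws \<in> ?L \<longleftrightarrow> length ws = length fs \<and>
      (\<forall>j<length fs. ws ! j \<in> Poly_Mapping.keys (fs ! j))" for ws
    by (auto simp: in_listset_iff)
  have M_iff: "ws \<in> ?M \<longleftrightarrow> length ws = length fs \<and> ws ! i = {#} \<and>
      (\<forall>j<length fs. j \<noteq> i \<longrightarrow> ws ! j \<in> Poly_Mapping.keys (fs ! j))" for ws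
    using i by (auto simp: in_listset_iff nth_list_update split: if_splits)
  have c: "?c (ws[i := w]) = ?c ws" for ws w
    by (rule prod.cong) auto
  have "op_ext \<theta> fs = (\<Sum>ws\<in>?L. Poly_Mapping.single {#Op \<theta> ws#}
      (?c ws * Poly_Mapping.lookup (fs ! i) (ws ! i)))"
    unfolding op_ext_def
    by (rule sum.cong) (use i in \<open>auto simp: prod.remove[of _ i] mult.commute\<close>)
  \<comment> \<open>A tuple of words corresponds to its \<open>i\<close>-th entry together with the
    tuple in which that entry is replaced by the placeholder.\<close>
  also have "\<dots> = (\<Sum>(ws, w)\<in>?M \<times> Poly_Mapping.keys (fs ! i).
      Poly_Mapping.single {#Op \<theta> (ws[i := w])#} (?c ws * Poly_Mapping.lookup (fs ! i) w))"
    by (rule sum.reindex_bij_witness[of _ "\<lambda>(ws, w). ws[i := w]" "\<lambda>ws. (ws[i := {#}], ws ! i)"])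
      (use i in \<open>auto simp: L_iff M_iff nth_list_update c intro!: nth_equalityI\<close>)
  also have "\<dots> = (\<Sum>ws\<in>?M. \<Sum>w\<in>Poly_Mapping.keys (fs ! i).
      Poly_Mapping.single {#Op \<theta> (ws[i := w])#} (?c ws * Poly_Mapping.lookup (fs ! i) w))"
    by (rule sum.cartesian_product[symmetric])
  also have "\<dots> = (\<Sum>ws\<in>?M. scale (?c ws) (linext (\<lambda>w. {#Op \<theta> (ws[i := w])#}) (fs ! i)))"
    by (simp add: linext_def poly.scale_sum_right scale_single)
  finally show ?thesis .
qed


section \<open>The structure of words\<close>

definition factors :: "'x set \<Rightarrow> (nat \<Rightarrow> 'o set) \<Rightarrow> ('x, 'o) factor set" where
  "factors X Om = Var ` X \<union> op_exprs Om (cwords X Om)"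

lemma finite_subset_incseq:
  assumes "finite F" "F \<subseteq> (\<Union>n. B n)" "\<And>m n::nat. m \<le> n \<Longrightarrow> B m \<subseteq> B n"
  shows "\<exists>n. F \<subseteq> B n"
  using assms(1,2)
proof (induction F)
  case (insert a F)
  then obtain m n where "a \<in> B m" "F \<subseteq> B n" by auto
  then show ?case
    using assms(3)[of m "max m n"] assms(3)[of n "max m n"]
    by (intro exI[of _ "max m n"]) auto
qed simp

lemma CS_mono: "Y \<subseteq> Z \<Longrightarrow> CS Y \<subseteq> CS Z"
  by (auto simp: CS_def)

lemma op_exprs_mono: "W \<subseteq> W' \<Longrightarrow> op_exprs Om W \<subseteq> op_exprs Om W'"
  unfolding op_exprs_def by blast

lemma cwords_upto_mono:
  assumes "m \<le> n" shows "cwords_upto X Om m \<subseteq> cwords_upto X Om n"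
proof -
  have "cwords_upto X Om n \<subseteq> cwords_upto X Om (Suc n)" for n
  proof (induction n)
    case 0
    show ?case by (auto simp: CS_def)
  next
    case (Suc n)
    then show ?case
      by (simp only: cwords_upto.simps) (intro CS_mono Un_mono order_refl op_exprs_mono)
  qed
  then show ?thesis
    using assms by (rule lift_Suc_mono_le)
qed

text \<open>Argument lists are finite and the levels increase, so all arguments of one expression
  occur at a common level.\<close>

lemma op_exprs_cwords: "op_exprs Om (cwords X Om) = (\<Union>n. op_exprs Om (cwords_upto X Om n))"
proof
  show "op_exprs Om (cwords X Om) \<subseteq> (\<Union>n. op_exprs Om (cwords_upto X Om n))"
  proof
    fix t assume "t \<in> op_exprs Om (cwords X Om)"
    then obtain \<theta> us where t: "t = Op \<theta> us" "length us \<ge> 1" "\<theta> \<in> Om (length us)"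
      "set us \<subseteq> cwords X Om"
      by (auto simp: op_exprs_def)
    have "\<exists>n. set us \<subseteq> cwords_upto X Om n"
      using t(4) by (intro finite_subset_incseq cwords_upto_mono) (auto simp: cwords_def)
    then obtain n where "set us \<subseteq> cwords_upto X Om n" ..
    with t show "t \<in> (\<Union>n. op_exprs Om (cwords_upto X Om n))"
      by (auto simp: op_exprs_def)
  qed
  show "(\<Union>n. op_exprs Om (cwords_upto X Om n)) \<subseteq> op_exprs Om (cwords X Om)"
    by (intro UN_least op_exprs_mono) (auto simp: cwords_def)
qed

text \<open>The description of words without levels, used from here on. A multiset has finitely many
  factors, so again a single level contains them all.\<close>

lemma cwords_eq: "cwords X Om = CS (factors X Om)"
proof
  have "cwords_upto X Om n \<subseteq> CS (factors X Om)" for n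
  proof (cases n)
    case 0
    then show ?thesis by (auto simp: CS_def factors_def)
  next
    case (Suc m)
    have "cwords_upto X Om m \<subseteq> cwords X Om" by (auto simp: cwords_def)
    then show ?thesis
      unfolding Suc cwords_upto.simps factors_def
      by (intro CS_mono Un_mono order_refl op_exprs_mono)
  qed
  then show "cwords X Om \<subseteq> CS (factors X Om)"
    unfolding cwords_def by blast
  show "CS (factors X Om) \<subseteq> cwords X Om"
  proof
    fix w assume w: "w \<in> CS (factors X Om)"
    have "\<exists>n. set_mset w \<subseteq> Var ` X \<union> op_exprs Om (cwords_upto X Om n)"
    proof (rule finite_subset_incseq)
      show "set_mset w \<subseteq> (\<Union>n. Var ` X \<union> op_exprs Om (cwords_upto X Om n))"
        using w by (auto simp: CS_def factors_def op_exprs_cwords)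
      show "Var ` X \<union> op_exprs Om (cwords_upto X Om m) \<subseteq> Var ` X \<union> op_exprs Om (cwords_upto X Om n)"
        if "m \<le> n" for m n
        using that by (intro Un_mono order_refl op_exprs_mono cwords_upto_mono)
    qed simp
    then obtain n where "w \<in> cwords_upto X Om (Suc n)"
      using w by (auto simp: CS_def)
    then show "w \<in> cwords X Om"
      unfolding cwords_def by blast
  qed
qed

lemma in_cwords_iff: "w \<in> cwords X Om \<longleftrightarrow> w \<noteq> {#} \<and> set_mset w \<subseteq> factors X Om"
  by (simp add: cwords_eq CS_def)

lemma Var_in_factors [simp]: "Var x \<in> factors X Om \<longleftrightarrow> x \<in> X"
  by (auto simp: factors_def op_exprs_def)

lemma Op_in_factors [simp]:
  "Op \<theta> us \<in> factors X Om \<longleftrightarrow> us \<noteq> [] \<and> \<theta> \<in> Om (length us) \<and> set us \<subseteq> cwords X Om"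
  by (auto simp: factors_def op_exprs_def Suc_le_eq)


section \<open>Contexts\<close>

text \<open>
  A context is the map \<open>w \<mapsto> u|\<^sub>w\<close> given by a word \<open>u\<close> with one hole; the factors of \<open>u\<close> other than
  the one containing the hole form \<open>c\<close>, which may be empty.
\<close>

inductive_set contexts ::
    "'x set \<Rightarrow> (nat \<Rightarrow> 'o set) \<Rightarrow> (('x, 'o) cword \<Rightarrow> ('x, 'o) cword) set"
  for X :: "'x set" and Om :: "nat \<Rightarrow> 'o set" where
  times: "set_mset c \<subseteq> factors X Om \<Longrightarrow> (\<lambda>w. c + w) \<in> contexts X Om"
| operator:
    "\<lbrakk>set_mset c \<subseteq> factors X Om; \<phi> \<in> contexts X Om; i < length vs; \<theta> \<in> Om (length vs);
      \<forall>j<length vs. j \<noteq> i \<longrightarrow> vs ! j \<in> cwords X Om\<rbrakk> \<Longrightarrow> (\<lambda>w. c + {#Op \<theta> (vs[i := \<phi> w])#}) \<in> contexts X Om"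

lemma set_list_update_subset_iff:
  "i < length vs \<Longrightarrow>
    set (vs[i := w]) \<subseteq> W \<longleftrightarrow> w \<in> W \<and> (\<forall>j<length vs. j \<noteq> i \<longrightarrow> vs ! j \<in> W)"
  by (auto simp: subset_iff in_set_conv_nth nth_list_update)

lemma context_id: "(\<lambda>w. w) \<in> contexts X Om"
proof -
  have "(\<lambda>w. w) = (\<lambda>w. {#} + w)"
    by simp
  then show ?thesis
    by (metis contexts.times empty_subsetI set_mset_empty)
qed

lemma context_in_cwords:
  "\<phi> \<in> contexts X Om \<Longrightarrow> w \<in> cwords X Om \<Longrightarrow> \<phi> w \<in> cwords X Om"
proof (induction rule: contexts.induct)
  case (operator c \<phi> i vs \<theta>)
  then show ?case
    by (auto simp: in_cwords_iff[of "add_mset _ _"] set_list_update_subset_iff)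
qed (auto simp: in_cwords_iff)

lemma context_add:
  assumes "set_mset c \<subseteq> factors X Om" "\<phi> \<in> contexts X Om"
  shows "(\<lambda>w. c + \<phi> w) \<in> contexts X Om"
  using assms(2)
proof cases
  case (times d)
  then have "(\<lambda>w. c + \<phi> w) = (\<lambda>w. (c + d) + w)"
    by (simp add: fun_eq_iff add.assoc)
  moreover have "(\<lambda>w. (c + d) + w) \<in> contexts X Om"
    by (rule contexts.times) (use times assms(1) in simp)
  ultimately show ?thesis
    by simp
next
  case (operator d \<psi> i vs \<theta>)
  then show ?thesis
    using contexts.operator[of "c + d" X Om \<psi> i vs \<theta>] assms(1) by (simp add: add.assoc)
qed

lemma context_op:
  "\<lbrakk>\<phi> \<in> contexts X Om; i < length vs; \<theta> \<in> Om (length vs);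
      \<forall>j<length vs. j \<noteq> i \<longrightarrow> vs ! j \<in> cwords X Om\<rbrakk>
    \<Longrightarrow> (\<lambda>w. {#Op \<theta> (vs[i := \<phi> w])#}) \<in> contexts X Om"
  using contexts.operator[of "{#}"] by simp

text \<open>Induction on the outer context; filling its hole with \<open>\<psi>\<close> affects only
  the innermost \<open>times\<close>, which \<open>context_add\<close> handles.\<close>

lemma context_comp:
  "\<phi> \<in> contexts X Om \<Longrightarrow> \<psi> \<in> contexts X Om \<Longrightarrow> (\<lambda>w. \<phi> (\<psi> w)) \<in> contexts X Om"
  by (induction rule: contexts.induct) (rule context_add contexts.operator, assumption+)+

section \<open>Words with one hole act as contexts\<close>

text \<open>The statement proved by structural induction. Parts of a word with one hole may have no
  hole, so both counts are treated together. The clause on \<open>c = {#}\<close> ensures that a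
  nonempty part without hole yields an actual word, as an operator argument must be.\<close>

definition hole_correct ::
    "'x set \<Rightarrow> (nat \<Rightarrow> 'o set) \<Rightarrow> ('x, 'o, 'k::comm_ring_1) cpoly \<Rightarrow> ('x option, 'o) cword \<Rightarrow> bool" where
  "hole_correct X Om s u \<longleftrightarrow>
     (\<Sum>\<^sub># (image_mset holes u) = 0 \<longrightarrow>
        (\<exists>c. set_mset c \<subseteq> factors X Om \<and> (c = {#} \<longrightarrow> u = {#}) \<and> (\<forall>v. plug_word u v = c) \<and>
             plug u s = word_poly c)) \<and>
     (\<Sum>\<^sub># (image_mset holes u) = 1 \<longrightarrow>
        plug_word u \<in> contexts X Om \<and> plug u s = linext (plug_word u) s)"

lemma plug_word_add: "plug_word (u + v) w = plug_word u w + plug_word v w"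
  by (simp add: plug_word_def)

lemma plug_add: "plug (u + v) s = plug u s * plug v s"
  by (simp add: plug_def)

lemma linext_add_word: "linext (\<lambda>w. c + \<phi> w) f = word_poly c * linext \<phi> f"
  by (simp add: single_mult_eq linext_linext)

lemma hole_correct_add:
  assumes u: "hole_correct X Om s u" and v: "hole_correct X Om s v"
  shows "hole_correct X Om s (u + v)"
proof -
  \<comment> \<open>Stated for fresh \<open>u\<close> and \<open>v\<close>, since the hole may lie
    in either summand.\<close>
  have one: "plug_word (u + v) \<in> contexts X Om \<and> plug (u + v) s = linext (plug_word (u + v)) s"
    if u: "hole_correct X Om s u" and v: "hole_correct X Om s v"
      and holes_u: "\<Sum>\<^sub># (image_mset holes u) = 0" and holes_v: "\<Sum>\<^sub># (image_mset holes v) = 1"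
    for u v
  proof -
    obtain c where c: "set_mset c \<subseteq> factors X Om" "\<And>w. plug_word u w = c" "plug u s = word_poly c"
      using u holes_u unfolding hole_correct_def by blast
    have w: "plug_word (u + v) = (\<lambda>w. c + plug_word v w)"
      by (simp add: plug_word_add fun_eq_iff c)
    show ?thesis
      using v holes_v c(1,3) unfolding hole_correct_def w
      by (simp add: plug_add context_add linext_add_word)
  qed
  show ?thesis
    unfolding hole_correct_def
  proof (intro conjI impI)
    assume "\<Sum>\<^sub># (image_mset holes (u + v)) = 0"
    then have "\<Sum>\<^sub># (image_mset holes u) = 0" "\<Sum>\<^sub># (image_mset holes v) = 0"
      by simp_all
    then obtain c d where
      "set_mset c \<subseteq> factors X Om" "c = {#} \<longrightarrow> u = {#}" "\<forall>w. plug_word u w = c" "plug u s = word_poly c"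
      "set_mset d \<subseteq> factors X Om" "d = {#} \<longrightarrow> v = {#}" "\<forall>w. plug_word v w = d" "plug v s = word_poly d"
      using u v unfolding hole_correct_def by blast
    then show "\<exists>c. set_mset c \<subseteq> factors X Om \<and> (c = {#} \<longrightarrow> u + v = {#}) \<and>
        (\<forall>w. plug_word (u + v) w = c) \<and> plug (u + v) s = word_poly c"
      by (intro exI[of _ "c + d"]) (auto simp: plug_word_add plug_add mult_single)
  next
    assume "\<Sum>\<^sub># (image_mset holes (u + v)) = 1"
    then consider "\<Sum>\<^sub># (image_mset holes u) = 0" "\<Sum>\<^sub># (image_mset holes v) = 1"
      | "\<Sum>\<^sub># (image_mset holes v) = 0" "\<Sum>\<^sub># (image_mset holes u) = 1"
      by (auto simp: add_is_1)
    then have "plug_word (u + v) \<in> contexts X Om \<and> plug (u + v) s = linext (plug_word (u + v)) s"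
      using one[OF u v] one[OF v u] by cases (auto simp: add.commute)
    then show "plug_word (u + v) \<in> contexts X Om" "plug (u + v) s = linext (plug_word (u + v)) s"
      by blast+
  qed
qed

lemma hole_correct_empty: "hole_correct X Om s {#}"
  by (auto simp: hole_correct_def plug_word_def plug_def single_one intro!: exI[of _ "{#}"])

lemma hole_correct_mset:
  "(\<And>t. t \<in># u \<Longrightarrow> hole_correct X Om s {#t#}) \<Longrightarrow> hole_correct X Om s u"
proof (induction u)
  case (add t u)
  then show ?case
    using hole_correct_add[of X Om s "{#t#}" u] by simp
qed (rule hole_correct_empty)

text \<open>The other arguments are single words with coefficient 1, so the sum isolating slot
  \<open>i\<close> has just one term.\<close>

lemma op_ext_one_slot:
  assumes "i < length cs"
  shows "op_ext \<theta> ((map word_poly cs)[i := f]) = linext (\<lambda>w. {#Op \<theta> (cs[i := w])#}) f"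
proof -
  let ?fs = "(map word_poly cs)[i := f]"
  have "listset ((map Poly_Mapping.keys ?fs)[i := {{#}}]) = {cs[i := {#}]}"
    using assms
    by (auto simp: in_listset_iff nth_list_update intro!: nth_equalityI split: if_splits)
  moreover have "(\<Prod>j\<in>{..<length cs} - {i}. Poly_Mapping.lookup (?fs ! j) (cs[i := {#}] ! j)) = 1"
    by (rule prod.neutral) auto
  ultimately show ?thesis
    using assms by (simp add: op_ext_eq_sum_linext[of i])
qed

lemma op_ext_words:
  assumes "cs \<noteq> []"
  shows "op_ext \<theta> (map word_poly cs) = (word_poly {#Op \<theta> cs#} :: ('x, 'o, 'k::comm_ring_1) cpoly)"
proof -
  let ?f = "word_poly (cs ! 0) :: ('x, 'o, 'k) cpoly"
  have "(map word_poly cs)[0 := ?f] = map word_poly cs"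
    using assms by (intro nth_equalityI) (auto simp: nth_list_update)
  then show ?thesis
    using op_ext_one_slot[of 0 cs \<theta> ?f] assms by simp
qed

lemma sum_list_eq_1_imp_ex:
  fixes ns :: "nat list"
  assumes "sum_list ns = 1"
  shows "\<exists>i<length ns. ns ! i = 1 \<and> (\<forall>j<length ns. j \<noteq> i \<longrightarrow> ns ! j = 0)"
  using assms
proof (induction ns)
  case (Cons n ns)
  show ?case
  proof (cases "n = 0")
    case True
    then obtain i where "i < length ns" "ns ! i = 1" "\<forall>j<length ns. j \<noteq> i \<longrightarrow> ns ! j = 0"
      using Cons by auto
    then show ?thesis
      using True by (intro exI[of _ "Suc i"]) (auto simp: nth_Cons split: nat.splits)
  next
    case False
    then have "n = 1" "\<forall>m\<in>set ns. m = 0"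
      using Cons.prems by (auto simp: add_is_1 simp flip: sum_list_eq_0_iff)
    then show ?thesis
      by (intro exI[of _ 0]) (auto simp: nth_Cons split: nat.splits)
  qed
qed simp

text \<open>The holes of \<open>Op \<theta> us\<close> add up over the arguments. With no hole every
  argument is constant; with one hole exactly one argument carries it, and the operator acts
  linearly in that slot.\<close>

lemma hole_correct_factor:
  "t \<in> factors (insert None (Some ` X)) Om \<Longrightarrow> hole_correct X Om s {#t#}"
proof (induction t)
  case (Var y)
  show ?case
  proof (cases y)
    case None
    then show ?thesis
      by (simp add: hole_correct_def plug_word_def[abs_def] plug_def context_id)
  next
    case (Some x)
    then show ?thesis
      using Var
      by (auto simp: hole_correct_def plug_word_def[abs_def] plug_def intro!: exI[of _ "{#Var x#}"])
  qed
next
  case (Op \<theta> us)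
  let ?h = "\<lambda>u. \<Sum>\<^sub># (image_mset holes u)"
  have us: "us \<noteq> []" "\<theta> \<in> Om (length us)" "\<And>u. u \<in> set us \<Longrightarrow> u \<in> cwords (insert None (Some ` X)) Om"
    using Op.prems by auto
  have IH: "hole_correct X Om s u" if "u \<in> set us" for u
  proof (rule hole_correct_mset)
    fix t assume t: "t \<in># u"
    with us(3)[OF that] have "t \<in> factors (insert None (Some ` X)) Om"
      unfolding in_cwords_iff by blast
    then show "hole_correct X Om s {#t#}"
      by (rule Op.IH[OF that t])
  qed
  have plug_word_Op: "plug_word {#Op \<theta> us#} v = {#Op \<theta> (map (\<lambda>u. plug_word u v) us)#}" for v
    by (simp add: plug_word_def comp_def)
  have plug_Op: "plug {#Op \<theta> us#} s = op_ext \<theta> (map (\<lambda>u. plug u s) us)"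
    by (simp add: plug_def[abs_def] comp_def)
  have holes_Op: "?h {#Op \<theta> us#} = sum_list (map ?h us)"
    by (simp add: comp_def)
  have const: "\<exists>c. c \<in> cwords X Om \<and> (\<forall>v. plug_word u v = c) \<and> plug u s = word_poly c"
    if "u \<in> set us" "?h u = 0" for u
    using IH[OF that(1)] us(3)[OF that(1)] that(2)
    unfolding hole_correct_def by (auto simp: in_cwords_iff)
  have const_Op: "\<exists>c. set_mset c \<subseteq> factors X Om \<and> (c = {#} \<longrightarrow> {#Op \<theta> us#} = {#}) \<and>
      (\<forall>v. plug_word {#Op \<theta> us#} v = c) \<and> plug {#Op \<theta> us#} s = word_poly c"
    if "?h {#Op \<theta> us#} = 0"
  proof -
    have "\<forall>u\<in>set us. \<exists>c. c \<in> cwords X Om \<and> (\<forall>v. plug_word u v = c) \<and> plug u s = word_poly c"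
      using that const unfolding holes_Op by simp
    then obtain C where C: "\<And>u. u \<in> set us \<Longrightarrow> C u \<in> cwords X Om"
        "\<And>u v. u \<in> set us \<Longrightarrow> plug_word u v = C u"
        "\<And>u. u \<in> set us \<Longrightarrow> plug u s = word_poly (C u)"
      by metis
    have "map (\<lambda>u. plug u s) us = map word_poly (map C us)"
      by (simp add: C(3))
    then have "plug {#Op \<theta> us#} s = word_poly {#Op \<theta> (map C us)#}"
      unfolding plug_Op using us(1) by (simp only: op_ext_words map_is_Nil_conv not_False_eq_True)
    moreover have "plug_word {#Op \<theta> us#} v = {#Op \<theta> (map C us)#}" for v
      using C(2) by (simp add: plug_word_Op cong: map_cong)
    ultimately show ?thesis
      using us C(1) by (intro exI[of _ "{#Op \<theta> (map C us)#}"]) auto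
  qed
  have ctx_Op: "plug_word {#Op \<theta> us#} \<in> contexts X Om \<and>
      plug {#Op \<theta> us#} s = linext (plug_word {#Op \<theta> us#}) s"
    if one: "?h {#Op \<theta> us#} = 1"
  proof -
    obtain i where i: "i < length us" "?h (us ! i) = 1" "\<And>j. j < length us \<Longrightarrow> j \<noteq> i \<Longrightarrow> ?h (us ! j) = 0"
      using sum_list_eq_1_imp_ex[OF one[unfolded holes_Op]] by auto
    have "\<forall>j. \<exists>c. j < length us \<and> j \<noteq> i \<longrightarrow>
        c \<in> cwords X Om \<and> (\<forall>v. plug_word (us ! j) v = c) \<and> plug (us ! j) s = word_poly c"
      using const[OF nth_mem i(3)] by blast
    then obtain C where C: "\<And>j. j < length us \<Longrightarrow> j \<noteq> i \<Longrightarrow> C j \<in> cwords X Om"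
        "\<And>j v. j < length us \<Longrightarrow> j \<noteq> i \<Longrightarrow> plug_word (us ! j) v = C j"
        "\<And>j. j < length us \<Longrightarrow> j \<noteq> i \<Longrightarrow> plug (us ! j) s = word_poly (C j)"
      by metis
    \<comment> \<open>Nothing is known about \<open>C i\<close>; this entry is always
      overwritten.\<close>
    define cs where "cs = map C [0..<length us]"
    have hole: "plug_word (us ! i) \<in> contexts X Om" "plug (us ! i) s = linext (plug_word (us ! i)) s"
      using IH[OF nth_mem[OF i(1)]] i(2) unfolding hole_correct_def by blast+
    have word: "plug_word {#Op \<theta> us#} = (\<lambda>v. {#Op \<theta> (cs[i := plug_word (us ! i) v])#})"
      using i(1) C(2)
      by (auto simp: plug_word_Op cs_def nth_list_update fun_eq_iff intro!: nth_equalityI)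
    have "map (\<lambda>u. plug u s) us = (map word_poly cs)[i := plug (us ! i) s]"
      using i(1) C(3) by (auto simp: cs_def nth_list_update intro!: nth_equalityI)
    then have "plug {#Op \<theta> us#} s = linext (\<lambda>v. {#Op \<theta> (cs[i := v])#}) (plug (us ! i) s)"
      unfolding plug_Op using i(1) by (simp only: op_ext_one_slot cs_def length_map length_upt diff_zero)
    moreover have "(\<lambda>v. {#Op \<theta> (cs[i := plug_word (us ! i) v])#}) \<in> contexts X Om"
      using i(1) us(2) C(1) by (intro context_op hole(1)) (auto simp: cs_def)
    ultimately show ?thesis
      by (simp add: word hole(2) linext_linext)
  qed
  show ?case
    unfolding hole_correct_def using const_Op ctx_Op by blast
qed

text \<open>Turns substitution of polynomials into composition of maps on words, where nesting is
  handled by \<open>linext_linext\<close>.\<close>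

lemma star_word_context:
  fixes s :: "('x, 'o, 'k::comm_ring_1) cpoly"
  assumes "u \<in> star_words X Om"
  shows "plug_word u \<in> contexts X Om" "plug u s = linext (plug_word u) s"
proof -
  have "hole_correct X Om s u"
    using assms unfolding star_words_def in_cwords_iff
    by (blast intro: hole_correct_mset hole_correct_factor)
  then show "plug_word u \<in> contexts X Om" "plug u s = linext (plug_word u) s"
    using assms by (auto simp: hole_correct_def star_words_def)
qed

section \<open>Every context comes from a word with one hole\<close>

abbreviation embed :: "('x, 'o) cword \<Rightarrow> ('x option, 'o) cword" where
  "embed \<equiv> image_mset (map_factor Some (\<lambda>\<theta>. \<theta>))"

lemma holes_map_factor: "holes (map_factor Some (\<lambda>\<theta>. \<theta>) t) = 0"
  by (induction t) (auto simp: image_mset.compositionality comp_def sum_mset.neutral)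

lemma plug_word_map_factor: "plug_word_factor v (map_factor Some (\<lambda>\<theta>. \<theta>) t) = {#t#}"
proof (induction t)
  case (Op \<theta> us)
  have "\<Sum>\<^sub># (image_mset (plug_word_factor v) (embed u)) = u" if "u \<in> set us" for u
  proof -
    have "image_mset (plug_word_factor v) (embed u) = image_mset (\<lambda>t. {#t#}) u"
      unfolding image_mset.compositionality comp_def
      by (rule image_mset_cong) (rule Op[OF that])
    then show ?thesis by simp
  qed
  then show ?case
    by (simp add: comp_def map_idI)
qed simp

lemma plug_word_embed: "plug_word (embed c) v = c"
  by (simp add: plug_word_def image_mset.compositionality comp_def plug_word_map_factor)

lemma map_factor_in_factors:
  "t \<in> factors X Om \<Longrightarrow> map_factor Some (\<lambda>\<theta>. \<theta>) t \<in> factors (insert None (Some ` X)) Om"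
proof (induction t)
  case (Op \<theta> us)
  then show ?case
    by (auto simp: in_cwords_iff subset_iff)
qed simp

lemma embed_factors:
  "set_mset c \<subseteq> factors X Om \<Longrightarrow> set_mset (embed c) \<subseteq> factors (insert None (Some ` X)) Om"
  using map_factor_in_factors by fastforce

lemma embed_cwords: "c \<in> cwords X Om \<Longrightarrow> embed c \<in> cwords (insert None (Some ` X)) Om"
  using embed_factors unfolding in_cwords_iff by (metis image_mset_is_empty_iff)

text \<open>The fixed parts of the context are embedded as words without hole, and
  \<open>Var None\<close> marks the place of the argument.\<close>

lemma context_star_word:
  "\<phi> \<in> contexts X Om \<Longrightarrow> \<exists>u\<in>star_words X Om. plug_word u = \<phi>"
proof (induction rule: contexts.induct)
  case (times c)
  let ?u = "embed c + {#Var None#}"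
  have "?u \<in> star_words X Om"
    using embed_factors[OF times] by (simp add: star_words_def in_cwords_iff holes_map_factor)
  moreover have "plug_word ?u = (\<lambda>w. c + w)"
    by (rule ext) (simp only: plug_word_add plug_word_embed, simp add: plug_word_def)
  ultimately show ?case by blast
next
  case (operator c \<phi> i vs \<theta>)
  then obtain u where u: "u \<in> star_words X Om" "plug_word u = \<phi>" by blast
  let ?us = "(map embed vs)[i := u]"
  let ?u = "embed c + {#Op \<theta> ?us#}"
  have "set ?us \<subseteq> cwords (insert None (Some ` X)) Om"
    using operator(3,5) u(1) by (auto simp: set_list_update_subset_iff star_words_def intro: embed_cwords)
  moreover have "sum_list (map (\<lambda>u. \<Sum>\<^sub># (image_mset holes u)) ?us) = 1"
  proof -
    have "map (\<lambda>u. \<Sum>\<^sub># (image_mset holes u)) ?us = (map (\<lambda>_. 0) vs)[i := 1]"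
      using u(1) operator(3)
      by (intro nth_equalityI) (auto simp: nth_list_update holes_map_factor star_words_def)
    then show ?thesis
      using operator(3) by (simp only: sum_list_update length_map) simp
  qed
  moreover from calculation have "?u \<in> cwords (insert None (Some ` X)) Om"
    using embed_factors[OF operator(1)] operator(3,4) by (subst in_cwords_iff) auto
  ultimately have "?u \<in> star_words X Om"
    by (simp add: star_words_def holes_map_factor comp_def)
  moreover have "plug_word ?u = (\<lambda>w. c + {#Op \<theta> (vs[i := \<phi> w])#})"
  proof
    fix w
    have "plug_word {#Op \<theta> ?us#} w = {#Op \<theta> (map (\<lambda>u. plug_word u w) ?us)#}"
      by (simp add: plug_word_def comp_def)
    then show "plug_word ?u w = c + {#Op \<theta> (vs[i := \<phi> w])#}"
      by (simp only: plug_word_add plug_word_embed) (simp add: map_update comp_def plug_word_embed u(2))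
  qed
  ultimately show ?case by blast
qed

lemma contexts_eq: "contexts X Om = plug_word ` star_words X Om"
proof
  show "contexts X Om \<subseteq> plug_word ` star_words X Om"
    using context_star_word[of _ X Om] by (metis image_eqI subsetI)
  show "plug_word ` star_words X Om \<subseteq> contexts X Om"
    by (intro image_subsetI star_word_context(1))
qed


section \<open>Relative position of two contexts\<close>

text \<open>
  The possible positions of two occurrences \<open>\<phi> a = \<psi> b\<close> in a word: in disjoint places, one inside
  the other, or as overlapping products of factors of the same subword.
\<close>

inductive overlap ::
    "'x set \<Rightarrow> (nat \<Rightarrow> 'o set) \<Rightarrow> (('x, 'o) cword \<Rightarrow> ('x, 'o) cword) \<Rightarrow> ('x, 'o) cword \<Rightarrow>
     (('x, 'o) cword \<Rightarrow> ('x, 'o) cword) \<Rightarrow> ('x, 'o) cword \<Rightarrow> bool"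
  for X Om where
  disjoint:
    "\<lbrakk>\<And>v. v \<in> cwords X Om \<Longrightarrow> (\<lambda>w. \<theta> w v) \<in> contexts X Om;
      \<And>v. v \<in> cwords X Om \<Longrightarrow> (\<lambda>w. \<theta> v w) \<in> contexts X Om\<rbrakk>
     \<Longrightarrow> overlap X Om (\<lambda>w. \<theta> w b) a (\<lambda>w. \<theta> a w) b"
| inside:
    "\<lbrakk>\<phi> \<in> contexts X Om; \<chi> \<in> contexts X Om\<rbrakk> \<Longrightarrow> overlap X Om \<phi> (\<chi> b) (\<lambda>w. \<phi> (\<chi> w)) b"
| outside:
    "\<lbrakk>\<phi> \<in> contexts X Om; \<chi> \<in> contexts X Om\<rbrakk> \<Longrightarrow> overlap X Om (\<lambda>w. \<phi> (\<chi> w)) a \<phi> (\<chi> a)"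
| shared:
    "\<lbrakk>\<chi> \<in> contexts X Om; c \<in> cwords X Om; d \<in> cwords X Om; c + a = d + b;
      size (c + a) < size a + size b\<rbrakk>
     \<Longrightarrow> overlap X Om (\<lambda>w. \<chi> (c + w)) a (\<lambda>w. \<chi> (d + w)) b"

lemma overlap_sym: "overlap X Om \<phi> a \<psi> b \<Longrightarrow> overlap X Om \<psi> b \<phi> a"
proof (induction rule: overlap.induct)
  case (disjoint \<theta> b a)
  then show ?case
    using overlap.disjoint[of X Om "\<lambda>v w. \<theta> w v"] by blast
next
  case (shared \<chi> c d a b)
  then show ?case
    by (intro overlap.shared) (auto simp: add.commute)
qed (rule overlap.intros; assumption)+

text \<open>Every kind of position persists inside a larger context because contexts compose. This
  settles occurrences in the same argument of the same operator.\<close>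

lemma overlap_context:
  assumes "overlap X Om \<phi> a \<psi> b" "\<kappa> \<in> contexts X Om"
  shows "overlap X Om (\<lambda>w. \<kappa> (\<phi> w)) a (\<lambda>w. \<kappa> (\<psi> w)) b"
  using assms
proof (induction rule: overlap.induct)
  case (disjoint \<theta> b a)
  show ?case
    by (rule overlap.disjoint[of X Om "\<lambda>v w. \<kappa> (\<theta> v w)"])
      (rule context_comp[OF disjoint(3)], erule disjoint)+
next
  case (inside \<phi> \<chi> b)
  then show ?case
    by (intro overlap.inside[OF context_comp[of \<kappa>]])
next
  case (outside \<phi> \<chi> a)
  then show ?case
    by (intro overlap.outside[OF context_comp[of \<kappa>]])
next
  case (shared \<chi> c d a b)
  then show ?case
    by (intro overlap.shared[OF context_comp[of \<kappa>]])
qed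

text \<open>Both occurrences are sub-multisets of one multiset of factors. The cases are: no common
  factor, containment either way, and a proper partial overlap.\<close>

lemma overlap_times_times:
  assumes "set_mset c \<subseteq> factors X Om" "set_mset d \<subseteq> factors X Om"
    and a: "a \<in> cwords X Om" and b: "b \<in> cwords X Om" and eq: "c + a = d + b"
  shows "overlap X Om (\<lambda>w. c + w) a (\<lambda>w. d + w) b"
proof -
  consider "a \<inter># b = {#}" | "b \<subseteq># a" | "a \<subseteq># b" | "a \<inter># b \<noteq> {#}" "\<not> b \<subseteq># a" "\<not> a \<subseteq># b"
    by blast
  then show ?thesis
  proof cases
    case 1
    \<comment> \<open>Without common factors, each factor of \<open>a\<close> must come from
      \<open>d\<close> with its full multiplicity.\<close>
    have "a \<subseteq># d + b"
      by (simp flip: eq)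
    then have "count a x \<le> count d x" for x
      using mset_subset_eq_count[of a "d + b" x] arg_cong[OF 1, of "\<lambda>m. count m x"]
      by (auto simp: min_def split: if_splits)
    then have "a \<subseteq># d"
      by (rule mset_subset_eqI)
    then obtain e where d: "d = e + a"
      by (metis subset_mset.le_iff_add add.commute)
    then have c: "c = e + b"
      using eq by (simp add: ac_simps)
    have "overlap X Om (\<lambda>w. e + w + b) a (\<lambda>w. e + a + w) b"
    proof (rule overlap.disjoint)
      fix v assume v: "v \<in> cwords X Om"
      then have "(\<lambda>w. (e + v) + w) \<in> contexts X Om"
        by (intro contexts.times) (use assms(1) c in \<open>auto simp: in_cwords_iff\<close>)
      then show "(\<lambda>w. e + w + v) \<in> contexts X Om" "(\<lambda>w. e + v + w) \<in> contexts X Om"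
        by (simp_all add: ac_simps)
    qed
    then show ?thesis
      by (simp add: c d ac_simps)
  next
    case 2
    then obtain e where a: "a = e + b"
      by (metis subset_mset.le_iff_add add.commute)
    then have d: "d = c + e"
      using eq by (simp add: ac_simps)
    have "overlap X Om (\<lambda>w. c + w) (e + b) (\<lambda>w. c + (e + w)) b"
      by (rule overlap.inside; rule contexts.times) (use assms d in auto)
    then show ?thesis
      by (simp add: a d ac_simps)
  next
    case 3
    then obtain e where b: "b = e + a"
      by (metis subset_mset.le_iff_add add.commute)
    then have c: "c = d + e"
      using eq by (simp add: ac_simps)
    have "overlap X Om (\<lambda>w. d + (e + w)) a (\<lambda>w. d + w) (e + a)"
      by (rule overlap.outside; rule contexts.times) (use assms c in auto)
    then show ?thesis
      by (simp add: b c ac_simps)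
  next
    case 4
    \<comment> \<open>The least common multiple of \<open>a\<close> and \<open>b\<close> is the
      ambiguity; the surplus \<open>e\<close> goes into the outer context. The bound on the size can
      fail for \<open>c + a\<close> but holds for \<open>m\<close>, because
      \<open>a \<inter># b\<close> is nonempty.\<close>
    define m where "m = a \<union># b"
    have "a \<subseteq># c + a"
      by simp
    moreover have "b \<subseteq># c + a"
      unfolding eq by simp
    ultimately have "m \<subseteq># c + a"
      unfolding m_def by simp
    then obtain e where e: "c + a = e + m"
      by (metis subset_mset.le_iff_add add.commute)
    obtain p where p: "m = p + a"
      unfolding m_def by (metis subset_mset.le_iff_add subset_mset.sup_ge1 add.commute)
    obtain q where q: "m = q + b"
      unfolding m_def by (metis subset_mset.le_iff_add subset_mset.sup_ge2 add.commute)
    have "c + a = (e + p) + a"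
      using e by (simp add: p add.assoc)
    then have c: "c = e + p"
      by (rule add_right_imp_eq)
    have "d + b = (e + q) + b"
      using e eq by (simp add: q add.assoc)
    then have d: "d = e + q"
      by (rule add_right_imp_eq)
    have "p \<noteq> {#}" "q \<noteq> {#}"
      using 4 p q unfolding m_def
      by (metis add_0 subset_mset.sup_ge1 subset_mset.sup_ge2)+
    then have pq: "p \<in> cwords X Om" "q \<in> cwords X Om"
      using assms(1,2) by (auto simp: in_cwords_iff c d)
    have "size m + size (a \<inter># b) = size a + size b"
      unfolding m_def by (metis size_Un_Int)
    moreover have "size (a \<inter># b) > 0"
      using 4(1) by (simp add: nonempty_has_size)
    ultimately have "size (p + a) < size a + size b"
      using p by simp
    then have "overlap X Om (\<lambda>w. e + (p + w)) a (\<lambda>w. e + (q + w)) b"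
      by (intro overlap.shared[of "\<lambda>w. e + w"] contexts.times pq) (use assms c p q in auto)
    then show ?thesis
      by (simp add: c d ac_simps)
  qed
qed

text \<open>The factor containing \<open>b\<close> is either a factor of \<open>a\<close>, so that
  the second occurrence is inside the first, or one of \<open>c\<close>, so that they are
  disjoint.\<close>

lemma overlap_times_operator:
  assumes c: "set_mset c \<subseteq> factors X Om"
    and d: "set_mset d \<subseteq> factors X Om" "\<phi> \<in> contexts X Om" "i < length vs" "\<theta> \<in> Om (length vs)"
      "\<forall>j<length vs. j \<noteq> i \<longrightarrow> vs ! j \<in> cwords X Om"
    and a: "a \<in> cwords X Om" and b: "b \<in> cwords X Om"
    and eq: "c + a = d + {#Op \<theta> (vs[i := \<phi> b])#}"
  shows "overlap X Om (\<lambda>w. c + w) a (\<lambda>w. d + {#Op \<theta> (vs[i := \<phi> w])#}) b"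
proof -
  let ?t = "\<lambda>w. Op \<theta> (vs[i := \<phi> w])"
  have t: "?t w \<in> factors X Om" if "w \<in> cwords X Om" for w
    using context_in_cwords[OF d(2) that] d(3-5) by (auto simp: set_list_update_subset_iff)
  have "?t b \<in># c + a"
    by (simp add: eq)
  then consider "?t b \<in># a" | "?t b \<in># c"
    by auto
  then show ?thesis
  proof cases
    case 1
    then obtain e where ae: "a = e + {#?t b#}"
      by (metis add_mset_add_single insert_DiffM)
    then have de: "d = c + e"
      using eq by simp
    have "overlap X Om (\<lambda>w. c + w) (e + {#?t b#}) (\<lambda>w. c + (e + {#?t w#})) b"
      by (rule overlap.inside[of _ _ _ "\<lambda>w. e + {#?t w#}"]; rule contexts.intros) (use c d de in auto)
    then show ?thesis
      by (simp add: ae de)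
  next
    case 2
    then obtain e where ce: "c = e + {#?t b#}"
      by (metis add_mset_add_single insert_DiffM)
    then have de: "d = e + a"
      using eq by simp
    have "overlap X Om (\<lambda>w. (e + w) + {#?t b#}) a (\<lambda>w. (e + a) + {#?t w#}) b"
    proof (rule overlap.disjoint)
      fix v assume v: "v \<in> cwords X Om"
      have "(\<lambda>w. (e + {#?t v#}) + w) \<in> contexts X Om"
        by (intro contexts.times) (use c ce t[OF v] in auto)
      then show "(\<lambda>w. (e + w) + {#?t v#}) \<in> contexts X Om"
        by (simp add: ac_simps)
      show "(\<lambda>w. (e + v) + {#?t w#}) \<in> contexts X Om"
        by (intro contexts.operator) (use c ce d v in \<open>auto simp: in_cwords_iff[of v]\<close>)
    qed
    then show ?thesis
      by (simp add: ce de ac_simps)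
  qed
qed

text \<open>Different factors, or different arguments of one factor, give disjoint occurrences. In
  the same argument of one factor the question passes to that argument, which is what
  \<open>IH\<close> covers. Equal factors may be taken as the same one, since a multiset does not
  distinguish copies.\<close>

lemma overlap_operator_operator:
  assumes c: "set_mset c \<subseteq> factors X Om" "\<phi> \<in> contexts X Om" "i < length vs" "\<theta> \<in> Om (length vs)"
      "\<forall>k<length vs. k \<noteq> i \<longrightarrow> vs ! k \<in> cwords X Om"
    and d: "set_mset d \<subseteq> factors X Om" "\<psi> \<in> contexts X Om" "j < length us" "\<eta> \<in> Om (length us)"
      "\<forall>k<length us. k \<noteq> j \<longrightarrow> us ! k \<in> cwords X Om"
    and a: "a \<in> cwords X Om" and b: "b \<in> cwords X Om"
    and eq: "c + {#Op \<theta> (vs[i := \<phi> a])#} = d + {#Op \<eta> (us[j := \<psi> b])#}"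
    and IH: "\<phi> a = \<psi> b \<Longrightarrow> overlap X Om \<phi> a \<psi> b"
  shows "overlap X Om (\<lambda>w. c + {#Op \<theta> (vs[i := \<phi> w])#}) a (\<lambda>w. d + {#Op \<eta> (us[j := \<psi> w])#}) b"
proof -
  let ?s = "\<lambda>w. Op \<theta> (vs[i := \<phi> w])" and ?t = "\<lambda>w. Op \<eta> (us[j := \<psi> w])"
  have s: "?s w \<in> factors X Om" if "w \<in> cwords X Om" for w
    using context_in_cwords[OF c(2) that] c(3-5) by (auto simp: set_list_update_subset_iff)
  have t: "?t w \<in> factors X Om" if "w \<in> cwords X Om" for w
    using context_in_cwords[OF d(2) that] d(3-5) by (auto simp: set_list_update_subset_iff)
  consider "?s a \<noteq> ?t b" | "?s a = ?t b" "i = j" | "?s a = ?t b" "i \<noteq> j"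
    by blast
  then show ?thesis
  proof cases
    case 1
    then have "?t b \<in># c"
      using eq by (metis add_mset_add_single insert_noteq_member)
    then obtain e where ce: "c = e + {#?t b#}"
      by (metis add_mset_add_single insert_DiffM)
    then have de: "d = e + {#?s a#}"
      using eq by simp
    have "overlap X Om (\<lambda>w. e + {#?s w#} + {#?t b#}) a (\<lambda>w. e + {#?s a#} + {#?t w#}) b"
    proof (rule overlap.disjoint)
      fix v assume v: "v \<in> cwords X Om"
      have "(\<lambda>w. (e + {#?t v#}) + {#?s w#}) \<in> contexts X Om"
        by (intro contexts.operator c(2-5)) (use c(1) ce t[OF v] in auto)
      then show "(\<lambda>w. e + {#?s w#} + {#?t v#}) \<in> contexts X Om"
        by (simp add: ac_simps)
      show "(\<lambda>w. (e + {#?s v#}) + {#?t w#}) \<in> contexts X Om"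
        by (intro contexts.operator d(2-5)) (use d(1) de s[OF v] c(1) ce in auto)
    qed
    then show ?thesis
      by (simp add: ce de ac_simps)
  next
    case 2
    then have "\<theta> = \<eta>" and lists: "vs[i := \<phi> a] = us[i := \<psi> b]" and cd: "c = d"
      using eq by auto
    have len: "length vs = length us"
      using arg_cong[OF lists, of length] by simp
    have "\<phi> a = \<psi> b"
      using arg_cong[OF lists, of "\<lambda>xs. xs ! i"] c(3) len by simp
    then have "overlap X Om \<phi> a \<psi> b"
      by (rule IH)
    moreover have "us[j := w] = vs[i := w]" for w
      using arg_cong[OF lists, of "\<lambda>xs. xs[i := w]"] 2 by simp
    ultimately show ?thesis
      using overlap_context[of X Om \<phi> a \<psi> b, OF _ contexts.operator[OF c(1) context_id c(3-5)]]
      by (simp add: \<open>\<theta> = \<eta>\<close> cd)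
  next
    case 3
    then have "\<theta> = \<eta>" and lists: "vs[i := \<phi> a] = us[j := \<psi> b]" and cd: "c = d"
      using eq by auto
    have len: "length vs = length us"
      using arg_cong[OF lists, of length] by simp
    \<comment> \<open>The lists \<open>vs\<close> and \<open>us\<close> carry arbitrary entries at
      their own slots. \<open>L\<close> is the actual common argument list, and both contexts become
      updates of \<open>L\<close> at two slots.\<close>
    define L where "L = vs[i := \<phi> a]"
    have L: "set L \<subseteq> cwords X Om" "length L = length vs"
      using c(3,5) context_in_cwords[OF c(2) a] by (simp_all add: L_def set_list_update_subset_iff)
    have Li: "L ! i = \<phi> a"
      using c(3) by (simp add: L_def)
    have Lj: "L ! j = \<psi> b"
      using d(3) by (simp add: L_def lists)
    have "L[i := w, j := L ! j] = L[i := w]" for w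
      using 3(2) by (subst list_update_swap) simp_all
    moreover have "L[i := w] = vs[i := w]" "L[j := w] = us[j := w]" for w
      by (simp add: L_def, simp add: L_def lists)
    moreover have "L[i := L ! i, j := w] = L[j := w]" for w
      by simp
    ultimately have L_eq: "L[i := w, j := \<psi> b] = vs[i := w]" "L[i := \<phi> a, j := w] = us[j := w]" for w
      unfolding Li Lj by simp_all
    have "overlap X Om (\<lambda>w. c + {#Op \<theta> (L[i := \<phi> w, j := \<psi> b])#}) a
        (\<lambda>w. c + {#Op \<theta> (L[i := \<phi> a, j := \<psi> w])#}) b"
    proof (rule overlap.disjoint)
      fix v assume v: "v \<in> cwords X Om"
      have "(\<lambda>w. c + {#Op \<theta> (L[j := \<psi> v, i := \<phi> w])#}) \<in> contexts X Om"
        using c d(3) len L context_in_cwords[OF d(2) v]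
        by (intro contexts.operator) (auto simp: nth_list_update)
      then show "(\<lambda>w. c + {#Op \<theta> (L[i := \<phi> w, j := \<psi> v])#}) \<in> contexts X Om"
        using 3(2) by (simp add: list_update_swap)
      show "(\<lambda>w. c + {#Op \<theta> (L[i := \<phi> v, j := \<psi> w])#}) \<in> contexts X Om"
        using c d(2,3) len L context_in_cwords[OF c(2) v]
        by (intro contexts.operator) (auto simp: nth_list_update)
    qed
    then show ?thesis
      by (simp add: L_eq cd \<open>\<theta> = \<eta>\<close>)
  qed
qed

text \<open>Both contexts are peeled simultaneously, hence \<open>\<psi>\<close> is generalized.
  Only the case of two operators recurses; the mixed cases are related by symmetry.\<close>

lemma context_overlap:
  assumes "\<phi> \<in> contexts X Om" "\<psi> \<in> contexts X Om" "a \<in> cwords X Om" "b \<in> cwords X Om" "\<phi> a = \<psi> b"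
  shows "overlap X Om \<phi> a \<psi> b"
  using assms
proof (induction arbitrary: \<psi> rule: contexts.induct)
  case (times c)
  from times(2) show ?case
  proof cases
    case (times d)
    then show ?thesis
      using overlap_times_times times.hyps times.prems by auto
  next
    case (operator d \<phi> i vs \<theta>)
    then show ?thesis
      using overlap_times_operator times.hyps times.prems by auto
  qed
next
  case (operator c \<phi> i vs \<theta>)
  from operator(7) show ?case
  proof cases
    case (times d)
    then show ?thesis
      unfolding times(1)
      by (intro overlap_sym[OF overlap_times_operator]) (use times operator.hyps operator.prems in auto)
  next
    case (operator d \<psi>' j us \<eta>)
    show ?thesis
      unfolding operator(1)
      by (rule overlap_operator_operator) (use operator operator.hyps operator.prems operator.IH in auto)
  qed
qed


section \<open>Leading words and the ideal\<close>

lemma keys_span_subset: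
  assumes "f \<in> poly.span B" "\<And>b. b \<in> B \<Longrightarrow> Poly_Mapping.keys b \<subseteq> A"
  shows "Poly_Mapping.keys f \<subseteq> A"
  using assms(1)
proof (induction rule: poly.span_induct_alt)
  case (step c x y)
  then show ?case
    using keys_add[of "scale c x" y] keys_scale_subset[of c x] assms(2)[of x] by blast
qed simp

text \<open>Both sides evaluate the bilinear extension of \<open>\<theta>\<close> at
  \<open>f\<close> and \<open>g\<close>, expanding one argument first or the other.\<close>

lemma double_linext:
  "(\<Sum>a\<in>Poly_Mapping.keys f. scale (Poly_Mapping.lookup f a) (linext (\<theta> a) g)) =
   (\<Sum>b\<in>Poly_Mapping.keys g. scale (Poly_Mapping.lookup g b) (linext (\<lambda>a. \<theta> a b) f))"
  unfolding linext_def poly.scale_sum_right scale_single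
  by (subst sum.swap) (simp add: mult.commute)

lemma word_poly_span: "f \<in> poly.span (word_poly ` Poly_Mapping.keys f)"
proof -
  have "(\<Sum>w\<in>Poly_Mapping.keys f. scale (Poly_Mapping.lookup f w) (word_poly w)) \<in>
      poly.span (word_poly ` Poly_Mapping.keys f)"
    by (intro poly.span_sum poly.span_scale poly.span_base) auto
  moreover have "f = (\<Sum>w\<in>Poly_Mapping.keys f. scale (Poly_Mapping.lookup f w) (word_poly w))"
    using poly_expansion[of "Poly_Mapping.keys f" f] by (simp add: scale_single)
  ultimately show ?thesis by simp
qed

lemma cpolys_iff: "f \<in> cpolys X Om \<longleftrightarrow> Poly_Mapping.keys f \<subseteq> cwords X Om"
  by (simp add: cpolys_def)

lemma subspace_cpolys: "poly.subspace (cpolys X Om)"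
  unfolding poly.subspace_def
  by (auto simp: cpolys_iff dest!: keys_add[THEN subsetD] keys_scale_subset[THEN subsetD])

lemma linext_in_cpolys: "\<phi> \<in> contexts X Om \<Longrightarrow> f \<in> cpolys X Om \<Longrightarrow> linext \<phi> f \<in> cpolys X Om"
  unfolding cpolys_iff using keys_linext_subset context_in_cwords by blast

lemma context_times_word: "c \<in> cwords X Om \<Longrightarrow> (+) c \<in> contexts X Om"
  by (intro contexts.times) (simp add: in_cwords_iff)

section \<open>Leading words of polynomials and of instances of \<open>S\<close>\<close>

locale monic_polys =
  fixes X :: "'x set"
    and Om :: "nat \<Rightarrow> 'o set"
    and r :: "(('x, 'o) cword \<times> ('x, 'o) cword) set"
    and S :: "('x, 'o, 'k::comm_ring_1) cpoly set"
  assumes order: "monomial_order X Om r"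
    and S_cpolys: "S \<subseteq> cpolys X Om"
    and S_monic: "\<forall>s\<in>S. monic r s"
begin

abbreviation lead :: "('x, 'o, 'k) cpoly \<Rightarrow> ('x, 'o) cword" where
  "lead \<equiv> lead_word r"

abbreviation less :: "('x, 'o) cword \<Rightarrow> ('x, 'o) cword \<Rightarrow> bool" (infix "\<prec>" 50) where
  "v \<prec> w \<equiv> (v, w) \<in> r - Id"

lemma well_order: "well_order_on (cwords X Om) r"
  using order by (simp add: monomial_order_def)

lemma r_refl: "w \<in> cwords X Om \<Longrightarrow> (w, w) \<in> r"
  and r_trans: "trans r"
  and r_antisym: "antisym r"
  and r_total: "v \<in> cwords X Om \<Longrightarrow> w \<in> cwords X Om \<Longrightarrow> (v, w) \<in> r \<or> (w, v) \<in> r"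
  and r_subset: "r \<subseteq> cwords X Om \<times> cwords X Om"
  and less_wf: "wf (r - Id)"
  using well_order unfolding order_on_defs refl_on_def total_on_def by (blast, blast, blast, metis, blast, blast)

lemma r_le_less_trans: "(u, v) \<in> r \<Longrightarrow> v \<prec> w \<Longrightarrow> u \<prec> w"
  using r_trans r_antisym by (auto dest: transD antisymD)

lemma context_mono: "\<phi> \<in> contexts X Om \<Longrightarrow> v \<prec> w \<Longrightarrow> \<phi> v \<prec> \<phi> w"
  using order r_subset unfolding contexts_eq monomial_order_def by blast

lemma context_mono_le:
  assumes "\<phi> \<in> contexts X Om" "(v, w) \<in> r"
  shows "(\<phi> v, \<phi> w) \<in> r"
proof (cases "v = w")
  case True
  have "v \<in> cwords X Om"
    using assms(2) r_subset by blast
  then show ?thesis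
    unfolding True[symmetric] by (intro r_refl context_in_cwords[OF assms(1)])
next
  case False
  then show ?thesis
    using context_mono[OF assms(1), of v w] assms(2) by blast
qed

text \<open>A finite nonempty set of words has a greatest element, unique by antisymmetry, so the
  description in \<open>lead_word\<close> is meaningful.\<close>

lemma lead_word_max:
  assumes "f \<in> cpolys X Om" "f \<noteq> 0"
  shows "lead f \<in> Poly_Mapping.keys f" "v \<in> Poly_Mapping.keys f \<Longrightarrow> (v, lead f) \<in> r"
proof -
  have ex: "\<exists>w\<in>A. \<forall>v\<in>A. (v, w) \<in> r" if "finite A" "A \<noteq> {}" "A \<subseteq> cwords X Om" for A
    using that
  proof (induction A rule: finite_ne_induct)
    case (insert x A)
    then obtain w where w: "w \<in> A" "\<forall>v\<in>A. (v, w) \<in> r" by auto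
    show ?case
      using w insert.prems r_total[of x w] r_refl[of x] transD[OF r_trans] by blast
  qed (auto intro: r_refl)
  have "\<exists>w. w \<in> Poly_Mapping.keys f \<and> (\<forall>v\<in>Poly_Mapping.keys f. (v, w) \<in> r)"
    using ex[of "Poly_Mapping.keys f"] assms by (auto simp: cpolys_iff)
  then have "\<exists>!w. w \<in> Poly_Mapping.keys f \<and> (\<forall>v\<in>Poly_Mapping.keys f. (v, w) \<in> r)"
    using antisymD[OF r_antisym] by blast
  from theI'[OF this] have "lead f \<in> Poly_Mapping.keys f \<and> (\<forall>v\<in>Poly_Mapping.keys f. (v, lead f) \<in> r)"
    unfolding lead_word_def .
  then show "lead f \<in> Poly_Mapping.keys f" "v \<in> Poly_Mapping.keys f \<Longrightarrow> (v, lead f) \<in> r"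
    by auto
qed

lemma
  assumes "s \<in> S"
  shows lead_S_keys: "lead s \<in> Poly_Mapping.keys s"
    and lead_S: "lead s \<in> cwords X Om"
    and lead_S_max: "v \<in> Poly_Mapping.keys s \<Longrightarrow> (v, lead s) \<in> r"
    and lookup_lead_S: "Poly_Mapping.lookup s (lead s) = 1"
proof -
  have s: "s \<in> cpolys X Om" "s \<noteq> 0" "Poly_Mapping.lookup s (lead s) = 1"
    using assms S_cpolys S_monic by (auto simp: monic_def)
  show "lead s \<in> Poly_Mapping.keys s" "v \<in> Poly_Mapping.keys s \<Longrightarrow> (v, lead s) \<in> r"
    using lead_word_max[OF s(1,2)] by auto
  then show "lead s \<in> cwords X Om"
    using s(1) by (auto simp: cpolys_iff)
  show "Poly_Mapping.lookup s (lead s) = 1" by (rule s(3))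
qed

lemma keys_linext_S:
  assumes "\<phi> \<in> contexts X Om" "s \<in> S" "v \<in> Poly_Mapping.keys (linext \<phi> s)"
  shows "(v, \<phi> (lead s)) \<in> r"
proof -
  obtain u where "v = \<phi> u" "u \<in> Poly_Mapping.keys s"
    using assms(3) keys_linext_subset[of \<phi> s] by blast
  then show ?thesis
    using context_mono_le[OF assms(1) lead_S_max[OF assms(2)]] by simp
qed

text \<open>Strict monotonicity keeps every other word of \<open>s\<close> away from the image of
  the leading word. With \<open>keys_linext_S\<close>, the instance is monic with leading word
  \<open>\<phi> (lead s)\<close>.\<close>

lemma lookup_linext_S:
  assumes "\<phi> \<in> contexts X Om" "s \<in> S"
  shows "Poly_Mapping.lookup (linext \<phi> s) (\<phi> (lead s)) = 1"
proof -
  have "v = lead s" if "v \<in> Poly_Mapping.keys s" "\<phi> v = \<phi> (lead s)" for v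
    using context_mono[OF assms(1), of v "lead s"] lead_S_max[OF assms(2) that(1)] that(2) by auto
  then show ?thesis
    using lookup_linext_inj[of s \<phi> "lead s"] lookup_lead_S[OF assms(2)] by simp
qed

text \<open>Instances of \<open>S\<close>, filtered by a condition on their leading words: no
  condition for the ideal, and bounds by a word, strict or not, for the induction.\<close>

definition gens :: "(('x, 'o) cword \<Rightarrow> bool) \<Rightarrow> ('x, 'o, 'k) cpoly set" where
  "gens P = {linext \<phi> s | \<phi> s. \<phi> \<in> contexts X Om \<and> s \<in> S \<and> P (\<phi> (lead s))}"

lemma gensI: "\<phi> \<in> contexts X Om \<Longrightarrow> s \<in> S \<Longrightarrow> P (\<phi> (lead s)) \<Longrightarrow> linext \<phi> s \<in> gens P"
  by (auto simp: gens_def)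

lemma gens_mono: "(\<And>v. P v \<Longrightarrow> Q v) \<Longrightarrow> gens P \<subseteq> gens Q"
  by (auto simp: gens_def)

lemma linext_span_gens:
  assumes "f \<in> poly.span (gens P)" "\<phi> \<in> contexts X Om" "\<And>v. P v \<Longrightarrow> Q (\<phi> v)"
  shows "linext \<phi> f \<in> poly.span (gens Q)"
  using assms(1)
proof (induction rule: poly.span_induct_alt)
  case base
  show ?case by (simp add: poly.span_zero)
next
  case (step c x y)
  obtain \<psi> s where x: "x = linext \<psi> s" "\<psi> \<in> contexts X Om" "s \<in> S" "P (\<psi> (lead s))"
    using step(1) by (auto simp: gens_def)
  have "linext (\<lambda>w. \<phi> (\<psi> w)) s \<in> gens Q"
    by (rule gensI[OF context_comp[OF assms(2) x(2)] x(3)]) (rule assms(3)[OF x(4)])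
  then show ?case
    using step(2) unfolding x(1) linext_add linext_scale linext_linext
    by (rule poly.span_add[OF poly.span_scale[OF poly.span_base]])
qed

text \<open>Replaces explicit lists of triples by membership in a span, with its closure
  properties.\<close>

lemma trivial_mod_iff: "trivial_mod X Om r S w h \<longleftrightarrow> h \<in> poly.span (gens (\<lambda>v. v \<prec> w))"
proof
  assume "trivial_mod X Om r S w h"
  then obtain ts :: "('k \<times> ('x option, 'o) cword \<times> ('x, 'o, 'k) cpoly) list" where
    ts: "\<forall>(\<alpha>, u, s)\<in>set ts. u \<in> star_words X Om \<and> s \<in> S \<and> plug_word u (lead s) \<prec> w"
    and h: "h = (\<Sum>(\<alpha>, u, s)\<leftarrow>ts. scale \<alpha> (plug u s))"
    unfolding trivial_mod_def by blast
  from ts have "(\<Sum>(\<alpha>, u, s)\<leftarrow>ts. scale \<alpha> (plug u s)) \<in> poly.span (gens (\<lambda>v. v \<prec> w))"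
  proof (induction ts)
    case Nil
    show ?case by (simp add: poly.span_zero)
  next
    case (Cons t ts)
    obtain \<alpha> u s where t: "t = (\<alpha>, u, s)" by (cases t)
    have "plug u s \<in> gens (\<lambda>v. v \<prec> w)"
      using Cons.prems star_word_context(1)[of u X Om] star_word_context(2)[of u X Om s]
        gensI[of "plug_word u" s "\<lambda>v. v \<prec> w"]
      by (simp add: t)
    then have "scale \<alpha> (plug u s) + (\<Sum>(\<alpha>, u, s)\<leftarrow>ts. scale \<alpha> (plug u s)) \<in>
        poly.span (gens (\<lambda>v. v \<prec> w))"
      using Cons.IH Cons.prems by (intro poly.span_add[OF poly.span_scale[OF poly.span_base]]) simp_all
    then show ?case
      by (simp add: t)
  qed
  then show "h \<in> poly.span (gens (\<lambda>v. v \<prec> w))" by (simp only: h)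
next
  assume "h \<in> poly.span (gens (\<lambda>v. v \<prec> w))"
  then show "trivial_mod X Om r S w h"
  proof (induction rule: poly.span_induct_alt)
    case base
    show ?case
      unfolding trivial_mod_def by (intro exI[of _ "[]"]) simp
  next
    case (step c x y)
    obtain \<phi> s where x: "x = linext \<phi> s" "\<phi> \<in> contexts X Om" "s \<in> S" "\<phi> (lead s) \<prec> w"
      using step(1) by (auto simp: gens_def)
    then obtain u where u: "u \<in> star_words X Om" "plug_word u = \<phi>"
      using context_star_word by blast
    obtain ts :: "('k \<times> ('x option, 'o) cword \<times> ('x, 'o, 'k) cpoly) list" where
      ts: "\<forall>(\<alpha>, u, s)\<in>set ts. u \<in> star_words X Om \<and> s \<in> S \<and> plug_word u (lead s) \<prec> w"
      and y: "y = (\<Sum>(\<alpha>, u, s)\<leftarrow>ts. scale \<alpha> (plug u s))"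
      using step(2) unfolding trivial_mod_def by blast
    show ?case
      unfolding trivial_mod_def
      using ts x u star_word_context(2)[OF u(1), of s] by (intro exI[of _ "(c, u, s) # ts"]) (auto simp: y)
  qed
qed

section \<open>The ideal as the span of all instances of \<open>S\<close>\<close>

abbreviation ideal_span :: "('x, 'o, 'k) cpoly set" where
  "ideal_span \<equiv> poly.span (gens (\<lambda>_. True))"

lemma span_gens_subset_ideal: "poly.span (gens P) \<subseteq> ideal_span"
  by (intro poly.span_mono gens_mono) simp

lemma linext_ideal_span: "f \<in> ideal_span \<Longrightarrow> \<phi> \<in> contexts X Om \<Longrightarrow> linext \<phi> f \<in> ideal_span"
  by (rule linext_span_gens) auto

lemma ideal_span_cpolys: "ideal_span \<subseteq> cpolys X Om"
  using S_cpolys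
  by (intro poly.span_minimal subspace_cpolys) (auto simp: gens_def intro!: linext_in_cpolys)

text \<open>Multiplication and application of an operator are sums of linear extensions of contexts,
  so closure under contexts suffices.\<close>

lemma operator_ideal_span: "operator_ideal X Om ideal_span"
  unfolding operator_ideal_def
proof (intro conjI ballI allI impI)
  fix f g :: "('x, 'o, 'k) cpoly" assume f: "f \<in> ideal_span" and g: "g \<in> cpolys X Om"
  have "linext ((+) v) f \<in> ideal_span" if "v \<in> Poly_Mapping.keys g" for v
    using g that by (intro linext_ideal_span f context_times_word) (auto simp: cpolys_iff)
  then show "g * f \<in> ideal_span"
    unfolding mult_eq_sum_linext by (intro poly.span_sum poly.span_scale)
next
  fix fs :: "('x, 'o, 'k) cpoly list" and \<theta>
  assume fs: "1 \<le> length fs \<and> \<theta> \<in> Om (length fs) \<and> set fs \<subseteq> cpolys X Om \<and> set fs \<inter> ideal_span \<noteq> {}"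
  then obtain i where i: "i < length fs" "fs ! i \<in> ideal_span"
    by (auto simp: in_set_conv_nth)
  have "linext (\<lambda>w. {#Op \<theta> (ws[i := w])#}) (fs ! i) \<in> ideal_span"
    if ws: "ws \<in> listset ((map Poly_Mapping.keys fs)[i := {{#}}])" for ws
  proof (rule linext_ideal_span[OF i(2)], rule context_op[OF context_id])
    have len: "length ws = length fs"
      using ws by (simp add: in_listset_iff)
    show "i < length ws" "\<theta> \<in> Om (length ws)"
      using fs i len by auto
    show "\<forall>j<length ws. j \<noteq> i \<longrightarrow> ws ! j \<in> cwords X Om"
    proof (intro allI impI)
      fix j assume j: "j < length ws" "j \<noteq> i"
      then have "ws ! j \<in> Poly_Mapping.keys (fs ! j)" "fs ! j \<in> set fs"
        using ws len by (auto simp: in_listset_iff)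
      then show "ws ! j \<in> cwords X Om"
        using fs by (auto simp: subset_iff cpolys_iff)
    qed
  qed
  then show "op_ext \<theta> fs \<in> ideal_span"
    unfolding op_ext_eq_sum_linext[OF i(1)] by (intro poly.span_sum poly.span_scale)
qed (use ideal_span_cpolys in \<open>auto intro: poly.span_add poly.span_scale poly.span_zero\<close>)

lemma word_poly_times_operator_ideal:
  assumes "operator_ideal X Om I" "f \<in> I" "c \<in> cwords X Om"
  shows "word_poly c * f \<in> I"
proof -
  have "word_poly c \<in> cpolys X Om"
    using assms(3) by (simp add: cpolys_iff)
  then show ?thesis
    using assms unfolding operator_ideal_def by blast
qed

lemma op_ext_operator_ideal:
  assumes "operator_ideal X Om I" "f \<in> I" "f \<in> set fs" "\<theta> \<in> Om (length fs)" "set fs \<subseteq> cpolys X Om"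
  shows "op_ext \<theta> fs \<in> I"
proof -
  have "1 \<le> length fs"
    using assms(3) by (cases fs) auto
  then show ?thesis
    using assms unfolding operator_ideal_def by blast
qed

text \<open>Conversely, a context is built by multiplying with words and applying operators with
  words in the other slots, and an operator ideal absorbs both.\<close>

lemma linext_operator_ideal:
  assumes I: "operator_ideal X Om I" and "f \<in> I"
  shows "\<phi> \<in> contexts X Om \<Longrightarrow> linext \<phi> f \<in> I"
proof (induction rule: contexts.induct)
  case (times c)
  show ?case
  \<comment> \<open>The algebra is not unital: \<open>word_poly {#}\<close> lies outside
    \<open>cpolys X Om\<close>, so the empty product is not an instance of absorption.\<close>
  proof (cases "c = {#}")
    case True
    then show ?thesis using \<open>f \<in> I\<close> by simp
  next
    case False
    then have "c \<in> cwords X Om"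
      using times by (simp add: in_cwords_iff)
    then show ?thesis
      using word_poly_times_operator_ideal[OF I \<open>f \<in> I\<close>] linext_add_word[of c "\<lambda>w. w" f] by simp
  qed
next
  case (operator c \<phi> i vs \<theta>)
  let ?fs = "(map word_poly vs)[i := linext \<phi> f]"
  have "linext \<phi> f \<in> cpolys X Om"
    using I operator.IH unfolding operator_ideal_def by blast
  then have "set ?fs \<subseteq> cpolys X Om"
    using operator(3,5) by (auto simp: set_list_update_subset_iff cpolys_iff)
  moreover have "linext \<phi> f \<in> set ?fs"
    using operator(3) by (simp add: set_update_memI)
  ultimately have "op_ext \<theta> ?fs \<in> I"
    using operator(4) by (intro op_ext_operator_ideal[OF I operator.IH]) simp_all
  then have I_op: "linext (\<lambda>w. {#Op \<theta> (vs[i := \<phi> w])#}) f \<in> I"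
    using operator(3) by (simp add: op_ext_one_slot linext_linext)
  show ?case
  proof (cases "c = {#}")
    case True
    then show ?thesis using I_op by simp
  next
    case False
    then have "c \<in> cwords X Om"
      using operator by (simp add: in_cwords_iff)
    then show ?thesis
      unfolding linext_add_word by (rule word_poly_times_operator_ideal[OF I I_op])
  qed
qed

lemma Id_gen_eq: "Id_gen X Om S = ideal_span"
proof
  have "S \<subseteq> ideal_span"
    using gensI[OF context_id] by (force intro: poly.span_base)
  then show "Id_gen X Om S \<subseteq> ideal_span"
    unfolding Id_gen_def using operator_ideal_span by blast
  have "ideal_span \<subseteq> I" if I: "operator_ideal X Om I" "S \<subseteq> I" for I
  proof (rule poly.span_minimal)
    show "gens (\<lambda>_. True) \<subseteq> I"
      using linext_operator_ideal[OF I(1)] I(2) by (auto simp: gens_def)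
    show "poly.subspace I"
      using I(1) unfolding operator_ideal_def poly.subspace_def by blast
  qed
  then show "ideal_span \<subseteq> Id_gen X Om S"
    unfolding Id_gen_def by blast
qed

end


section \<open>The composition-diamond argument\<close>

context monic_polys
begin

lemma less_in_cwords: "v \<prec> w \<Longrightarrow> v \<in> cwords X Om" "v \<prec> w \<Longrightarrow> w \<in> cwords X Om"
  using r_subset by blast+

text \<open>
  The sums in \<open>\<theta>(f, g) = \<Sum>\<^sub>a f\<^sub>a \<theta>(a, g) = \<Sum>\<^sub>b g\<^sub>b \<theta>(f, b)\<close> each contain one of the two polynomials to
  be compared; all their other summands have smaller leading words.
\<close>

lemma span_gens_disjoint:
  assumes f: "f \<in> S" and g: "g \<in> S"
    and ctx1: "\<And>v. v \<in> cwords X Om \<Longrightarrow> (\<lambda>w. \<theta> w v) \<in> contexts X Om"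
    and ctx2: "\<And>v. v \<in> cwords X Om \<Longrightarrow> \<theta> v \<in> contexts X Om"
  shows "linext (\<lambda>w. \<theta> w (lead g)) f - linext (\<theta> (lead f)) g \<in>
    poly.span (gens (\<lambda>v. v \<prec> \<theta> (lead f) (lead g)))"
proof -
  let ?w = "\<theta> (lead f) (lead g)"
  let ?A = "\<lambda>a. scale (Poly_Mapping.lookup f a) (linext (\<theta> a) g)"
  let ?B = "\<lambda>b. scale (Poly_Mapping.lookup g b) (linext (\<lambda>a. \<theta> a b) f)"
  have A: "?A a \<in> poly.span (gens (\<lambda>v. v \<prec> ?w))" if "a \<in> Poly_Mapping.keys f - {lead f}" for a
  proof -
    have a: "a \<prec> lead f"
      using that lead_S_max[OF f, of a] by auto
    then have "\<theta> a (lead g) \<prec> ?w"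
      using context_mono[OF ctx1[OF lead_S[OF g]]] by blast
    then have "linext (\<theta> a) g \<in> gens (\<lambda>v. v \<prec> ?w)"
      by (intro gensI ctx2 g less_in_cwords(1)[OF a])
    then show ?thesis
      by (intro poly.span_scale poly.span_base)
  qed
  have B: "?B b \<in> poly.span (gens (\<lambda>v. v \<prec> ?w))" if "b \<in> Poly_Mapping.keys g - {lead g}" for b
  proof -
    have b: "b \<prec> lead g"
      using that lead_S_max[OF g, of b] by auto
    then have "\<theta> (lead f) b \<prec> ?w"
      using context_mono[OF ctx2[OF lead_S[OF f]]] by blast
    then have "linext (\<lambda>a. \<theta> a b) f \<in> gens (\<lambda>v. v \<prec> ?w)"
      by (rule gensI[OF ctx1[OF less_in_cwords(1)[OF b]] f])
    then show ?thesis
      by (intro poly.span_scale poly.span_base)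
  qed
  \<comment> \<open>The leading coefficients are 1, so the summands split off are exactly the two
    polynomials being compared.\<close>
  have "linext (\<theta> (lead f)) g + sum ?A (Poly_Mapping.keys f - {lead f}) = sum ?A (Poly_Mapping.keys f)"
    using lead_S_keys[OF f] by (simp add: sum.remove lookup_lead_S[OF f])
  also have "\<dots> = sum ?B (Poly_Mapping.keys g)"
    by (rule double_linext)
  also have "\<dots> = linext (\<lambda>a. \<theta> a (lead g)) f + sum ?B (Poly_Mapping.keys g - {lead g})"
    using lead_S_keys[OF g] by (simp add: sum.remove lookup_lead_S[OF g])
  finally have "linext (\<lambda>w. \<theta> w (lead g)) f - linext (\<theta> (lead f)) g =
      sum ?A (Poly_Mapping.keys f - {lead f}) - sum ?B (Poly_Mapping.keys g - {lead g})"
    by (simp add: algebra_simps)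
  then show ?thesis
    using A B by (simp only: poly.span_diff poly.span_sum)
qed

lemma linext_context_diff:
  assumes "f - g \<in> poly.span (gens (\<lambda>v. v \<prec> w))" "\<phi> \<in> contexts X Om"
  shows "linext \<phi> f - linext \<phi> g \<in> poly.span (gens (\<lambda>v. v \<prec> \<phi> w))"
  using linext_span_gens[OF assms, of "\<lambda>v. v \<prec> \<phi> w"] context_mono[OF assms(2)]
  by (simp add: linext_diff)

lemma gsb_inclusion:
  assumes gsb: "groebner_shirshov_basis X Om r S"
    and f: "f \<in> S" and g: "g \<in> S" and \<chi>: "\<chi> \<in> contexts X Om" and lead: "lead f = \<chi> (lead g)"
  shows "f - linext \<chi> g \<in> poly.span (gens (\<lambda>v. v \<prec> lead f))"
proof -
  obtain u where u: "u \<in> star_words X Om" "plug_word u = \<chi>"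
    using context_star_word[OF \<chi>] by blast
  then have "is_composition X Om r f g (lead f) (f - plug u g)"
    using lead by (intro is_composition.inclusion) simp_all
  then show ?thesis
    using gsb f g u star_word_context(2)[OF u(1), of g]
    unfolding groebner_shirshov_basis_def trivial_mod_iff by metis
qed

text \<open>Disjoint occurrences need no composition. Nested ones use an inclusion composition and
  shared ones an intersection composition, carried into the outer context by
  \<open>linext_context_diff\<close>.\<close>

lemma gsb_difference:
  assumes gsb: "groebner_shirshov_basis X Om r S"
    and f: "f \<in> S" and g: "g \<in> S"
    and \<phi>: "\<phi> \<in> contexts X Om" and \<psi>: "\<psi> \<in> contexts X Om"
    and eq: "\<phi> (lead f) = \<psi> (lead g)"
  shows "linext \<phi> f - linext \<psi> g \<in> poly.span (gens (\<lambda>v. v \<prec> \<phi> (lead f)))"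
proof -
  have "overlap X Om \<phi> (lead f) \<psi> (lead g)"
    by (rule context_overlap[OF \<phi> \<psi> lead_S[OF f] lead_S[OF g] eq])
  then show ?thesis
  proof cases
    case (disjoint \<theta>)
    then show ?thesis
      using span_gens_disjoint[OF f g, of \<theta>] by simp
  next
    case (inside \<chi>)
    have "linext \<phi> f - linext \<phi> (linext \<chi> g) \<in> poly.span (gens (\<lambda>v. v \<prec> \<phi> (lead f)))"
      by (rule linext_context_diff[OF gsb_inclusion[OF gsb f g inside(4,1)] \<phi>])
    then show ?thesis
      by (simp add: linext_linext inside(2))
  next
    case (outside \<chi>)
    have "linext \<psi> g - linext \<psi> (linext \<chi> f) \<in> poly.span (gens (\<lambda>v. v \<prec> \<psi> (lead g)))"
      by (rule linext_context_diff[OF gsb_inclusion[OF gsb g f outside(4,2)] \<psi>])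
    \<comment> \<open>Here \<open>f\<close> is the polynomial inside, so the composition is that of
      \<open>g\<close> and \<open>f\<close> and the sign is reversed.\<close>
    then have "- (linext \<psi> g - linext \<phi> f) \<in> poly.span (gens (\<lambda>v. v \<prec> \<phi> (lead f)))"
      unfolding linext_linext outside(1)[symmetric] eq by (rule poly.span_neg)
    then show ?thesis
      by simp
  next
    case (shared \<chi> c d)
    have "is_composition X Om r f g (c + lead f) (word_poly c * f - word_poly d * g)"
      using shared by (intro is_composition.intersection) (simp_all add: bre_def)
    then have "linext ((+) c) f - linext ((+) d) g \<in> poly.span (gens (\<lambda>v. v \<prec> c + lead f))"
      using gsb f g unfolding groebner_shirshov_basis_def trivial_mod_iff
      by (simp add: single_mult_eq)
    from linext_context_diff[OF this shared(3)] show ?thesis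
      by (simp add: linext_linext shared(1,2))
  qed
qed

section \<open>Reducible words and leading words of the ideal\<close>

definition reducible :: "('x, 'o) cword \<Rightarrow> bool" where
  "reducible w \<longleftrightarrow> (\<exists>\<phi>\<in>contexts X Om. \<exists>s\<in>S. w = \<phi> (lead s))"

lemma reducible_iff: "reducible w \<longleftrightarrow> (\<exists>u\<in>star_words X Om. \<exists>s\<in>S. w = plug_word u (lead s))"
  by (simp add: reducible_def contexts_eq)

lemma Irr_iff: "w \<in> Irr X Om r S \<longleftrightarrow> w \<in> cwords X Om \<and> \<not> reducible w"
  by (auto simp: Irr_def reducible_iff)

text \<open>All words of an instance are at most its leading word, so a downward closed condition
  passes to every word of a combination.\<close>

lemma keys_span_gens:
  assumes "f \<in> poly.span (gens P)" "\<And>v w. P w \<Longrightarrow> (v, w) \<in> r \<Longrightarrow> P v" "v \<in> Poly_Mapping.keys f"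
  shows "P v"
proof -
  have "Poly_Mapping.keys f \<subseteq> {v. P v}"
  proof (rule keys_span_subset[OF assms(1)])
    show "Poly_Mapping.keys b \<subseteq> {v. P v}" if "b \<in> gens P" for b
      using that keys_linext_S assms(2) by (auto simp: gens_def)
  qed
  then show ?thesis
    using assms(3) by blast
qed

text \<open>A combination involves finitely many instances, and the largest of their leading words
  bounds them all. Zero is separate, as it may come from the empty combination. This supplies the
  bound on which the induction runs.\<close>

lemma span_gens_bounded:
  assumes "f \<in> poly.span (gens P)"
  shows "f = 0 \<or> (\<exists>w. P w \<and> f \<in> poly.span (gens (\<lambda>v. (v, w) \<in> r)))"
  using assms
proof (induction rule: poly.span_induct_alt)
  case (step c x y)
  have le_mono: "poly.span (gens (\<lambda>u. (u, v) \<in> r)) \<subseteq> poly.span (gens (\<lambda>u. (u, w) \<in> r))"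
    if "(v, w) \<in> r" for v w
    using that transD[OF r_trans] by (intro poly.span_mono gens_mono) blast
  obtain \<phi> s where x: "x = linext \<phi> s" "\<phi> \<in> contexts X Om" "s \<in> S" "P (\<phi> (lead s))"
    using step(1) by (auto simp: gens_def)
  let ?v = "\<phi> (lead s)"
  have v: "?v \<in> cwords X Om"
    by (rule context_in_cwords[OF x(2) lead_S[OF x(3)]])
  then have xv: "scale c x \<in> poly.span (gens (\<lambda>u. (u, ?v) \<in> r))"
    unfolding x(1) by (intro poly.span_scale poly.span_base gensI x r_refl)
  from step(2) show ?case
  proof
    assume "y = 0"
    then show ?thesis using xv x(4) by auto
  next
    assume "\<exists>w. P w \<and> y \<in> poly.span (gens (\<lambda>v. (v, w) \<in> r))"
    then obtain w where w: "P w" "y \<in> poly.span (gens (\<lambda>v. (v, w) \<in> r))" by blast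
    show ?thesis
    proof (cases "(?v, w) \<in> r")
      case True
      then show ?thesis
        using poly.span_add[OF subsetD[OF le_mono[OF True] xv] w(2)] w(1) by blast
    next
      case False
      show ?thesis
      \<comment> \<open>Nothing but \<open>P w\<close> restricts \<open>w\<close>. If it is not a
        word, no instance lies below it and \<open>y\<close> is zero.\<close>
      proof (cases "w \<in> cwords X Om")
        case True
        then have "(w, ?v) \<in> r"
          using r_total[OF v True] False by blast
        then show ?thesis
          using poly.span_add[OF xv subsetD[OF le_mono w(2)]] x(4) by blast
      next
        case False
        then have "gens (\<lambda>v. (v, w) \<in> r) = {}"
          using r_subset by (auto simp: gens_def)
        then show ?thesis
          using w(2) xv x(4) by auto
      qed
    qed
  qed
qed simp

text \<open>By \<open>gsb_difference\<close>, instances with leading word exactly \<open>w\<close>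
  agree modulo smaller ones, so they merge into a single instance with one coefficient.\<close>

lemma gsb_span_le:
  assumes gsb: "groebner_shirshov_basis X Om r S"
    and "f \<in> poly.span (gens (\<lambda>v. (v, w) \<in> r))"
  shows "f \<in> poly.span (gens (\<lambda>v. v \<prec> w)) \<or>
    (\<exists>c. \<exists>\<phi>\<in>contexts X Om. \<exists>s\<in>S. \<phi> (lead s) = w \<and>
       f - scale c (linext \<phi> s) \<in> poly.span (gens (\<lambda>v. v \<prec> w)))"
    (is "?A f \<or> ?B f")
  using assms(2)
proof (induction rule: poly.span_induct_alt)
  case base
  show ?case by (simp add: poly.span_zero)
next
  case (step c x y)
  obtain \<phi> s where x: "x = linext \<phi> s" "\<phi> \<in> contexts X Om" "s \<in> S" "(\<phi> (lead s), w) \<in> r"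
    using step(1) by (auto simp: gens_def)
  show ?case
  proof (cases "\<phi> (lead s) = w")
    case False
    then have "x \<in> gens (\<lambda>v. v \<prec> w)"
      unfolding x(1) using x by (intro gensI) auto
    then have cx: "scale c x \<in> poly.span (gens (\<lambda>v. v \<prec> w))"
      by (intro poly.span_scale poly.span_base)
    from step(2) show ?thesis
    proof
      assume "?A y"
      then show ?thesis using poly.span_add[OF cx] by blast
    next
      assume "?B y"
      then obtain d \<psi> t where t: "\<psi> \<in> contexts X Om" "t \<in> S" "\<psi> (lead t) = w"
        "y - scale d (linext \<psi> t) \<in> poly.span (gens (\<lambda>v. v \<prec> w))" by blast
      have "scale c x + y - scale d (linext \<psi> t) \<in> poly.span (gens (\<lambda>v. v \<prec> w))"
        using poly.span_add[OF cx t(4)] by (simp add: add_diff_eq)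
      then show ?thesis using t(1-3) by blast
    qed
  next
    case True
    from step(2) show ?thesis
    proof
      assume "?A y"
      then have "scale c x + y - scale c (linext \<phi> s) \<in> poly.span (gens (\<lambda>v. v \<prec> w))"
        by (simp add: x(1))
      then show ?thesis using x True by blast
    next
      assume "?B y"
      then obtain d \<psi> t where t: "\<psi> \<in> contexts X Om" "t \<in> S" "\<psi> (lead t) = w"
        "y - scale d (linext \<psi> t) \<in> poly.span (gens (\<lambda>v. v \<prec> w))" by blast
      have "linext \<psi> t - linext \<phi> s \<in> poly.span (gens (\<lambda>v. v \<prec> w))"
        using gsb_difference[OF gsb t(2) x(3) t(1) x(2)] t(3) True by simp
      \<comment> \<open>The instance of \<open>t\<close> is exchanged for that of \<open>s\<close>,
        and the coefficients add up; their sum may vanish.\<close>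
      then have "(y - scale d (linext \<psi> t)) + scale d (linext \<psi> t - linext \<phi> s) \<in>
          poly.span (gens (\<lambda>v. v \<prec> w))"
        by (intro poly.span_add t(4) poly.span_scale)
      also have "(y - scale d (linext \<psi> t)) + scale d (linext \<psi> t - linext \<phi> s) =
          scale c x + y - scale (c + d) (linext \<phi> s)"
        by (simp add: x(1) poly.scale_right_diff_distrib poly.scale_left_distrib)
      finally show ?thesis using x True by blast
    qed
  qed
qed

text \<open>If the merged coefficient is nonzero, \<open>w\<close> is the leading word of
  \<open>f\<close>, and it is reducible. If it is zero, \<open>f\<close> is a combination strictly
  below \<open>w\<close> and the induction hypothesis applies.\<close>

lemma gsb_lead_reducible_le:
  assumes gsb: "groebner_shirshov_basis X Om r S"
  shows "f \<in> poly.span (gens (\<lambda>v. (v, w) \<in> r)) \<Longrightarrow> f \<noteq> 0 \<Longrightarrow> reducible (lead f)"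
proof (induction w arbitrary: f rule: wf_induct_rule[OF less_wf])
  case (1 w)
  have smaller: "reducible (lead f)" if "f \<in> poly.span (gens (\<lambda>v. v \<prec> w))"
    using span_gens_bounded[OF that] 1 by blast
  from gsb_span_le[OF gsb 1(2)] show ?case
  proof
    assume "\<exists>c. \<exists>\<phi>\<in>contexts X Om. \<exists>s\<in>S. \<phi> (lead s) = w \<and>
       f - scale c (linext \<phi> s) \<in> poly.span (gens (\<lambda>v. v \<prec> w))"
    then obtain c \<phi> s where s: "\<phi> \<in> contexts X Om" "s \<in> S" "\<phi> (lead s) = w"
      "f - scale c (linext \<phi> s) \<in> poly.span (gens (\<lambda>v. v \<prec> w))" by blast
    show ?case
    proof (cases "c = 0")
      case True
      then show ?thesis using s(4) smaller by simp
    next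
      case False
      \<comment> \<open>The remainder has only words strictly below \<open>w\<close>, so the
        coefficient of \<open>w\<close> in \<open>f\<close> comes from the monic instance alone and
        equals \<open>c\<close>, even when the ring has zero divisors.\<close>
      have "w \<notin> Poly_Mapping.keys (f - scale c (linext \<phi> s))"
        using keys_span_gens[OF s(4)] r_le_less_trans by blast
      then have "Poly_Mapping.lookup f w = c"
        using lookup_linext_S[OF s(1,2)] s(3) by (simp add: in_keys_iff lookup_minus lookup_scale)
      then have w: "w \<in> Poly_Mapping.keys f"
        using False by (simp add: in_keys_iff)
      have f: "f \<in> cpolys X Om"
        using 1(2) span_gens_subset_ideal ideal_span_cpolys by blast
      have "(lead f, w) \<in> r"
        using keys_span_gens[OF 1(2)] lead_word_max(1)[OF f 1(3)] transD[OF r_trans] by blast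
      then have "lead f = w"
        using lead_word_max(2)[OF f 1(3) w] antisymD[OF r_antisym] by blast
      then show ?thesis
        unfolding reducible_def using s(1-3) by (intro bexI[of _ \<phi>] bexI[of _ s]) simp_all
    qed
  qed (rule smaller)
qed

lemma gsb_lead_reducible:
  assumes "groebner_shirshov_basis X Om r S" "f \<in> ideal_span" "f \<noteq> 0"
  shows "reducible (lead f)"
  using span_gens_bounded[OF assms(2)] gsb_lead_reducible_le[OF assms(1)] assms(3) by blast

section \<open>Reduction to irreducible words\<close>

text \<open>A reducible word is the leading word of an instance, and subtracting that instance
  leaves smaller words. The bound on the instances used is what the treatment of compositions
  requires.\<close>

lemma word_poly_reduction:
  "w \<in> cwords X Om \<Longrightarrow>
    word_poly w \<in> poly.span (gens (\<lambda>v. (v, w) \<in> r) \<union> word_poly ` Irr X Om r S)"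
proof (induction w rule: wf_induct_rule[OF less_wf])
  case (1 w)
  let ?G = "\<lambda>w. gens (\<lambda>v. (v, w) \<in> r) \<union> word_poly ` Irr X Om r S"
  show ?case
  proof (cases "reducible w")
    case False
    then show ?thesis
      using 1 by (intro poly.span_base) (simp add: Irr_iff)
  next
    case True
    then obtain \<phi> s where s: "\<phi> \<in> contexts X Om" "s \<in> S" "w = \<phi> (lead s)"
      by (auto simp: reducible_def)
    let ?T = "\<lambda>v. scale (Poly_Mapping.lookup s v) (word_poly (\<phi> v))"
    have "?T v \<in> poly.span (?G w)" if "v \<in> Poly_Mapping.keys s - {lead s}" for v
    proof -
      have v: "\<phi> v \<prec> w"
        unfolding s(3) using lead_S_max[OF s(2), of v] that by (intro context_mono[OF s(1)]) blast
      have "?G (\<phi> v) \<subseteq> ?G w"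
        using v transD[OF r_trans] by (intro Un_mono gens_mono order_refl) blast
      then have "word_poly (\<phi> v) \<in> poly.span (?G w)"
        using 1(1)[OF v less_in_cwords(1)[OF v]] by (rule subsetD[OF poly.span_mono])
      then show ?thesis
        by (rule poly.span_scale)
    qed
    then have "sum ?T (Poly_Mapping.keys s - {lead s}) \<in> poly.span (?G w)"
      by (rule poly.span_sum)
    moreover have "linext \<phi> s \<in> poly.span (?G w)"
      using gensI[OF s(1,2), of "\<lambda>v. (v, w) \<in> r"] r_refl[OF 1(2)] s(3)
      by (intro poly.span_base) simp
    moreover have "linext \<phi> s = sum ?T (Poly_Mapping.keys s)"
      by (simp add: linext_def scale_single)
    then have "linext \<phi> s = word_poly w + sum ?T (Poly_Mapping.keys s - {lead s})"
      using lead_S_keys[OF s(2)] by (simp add: sum.remove lookup_lead_S[OF s(2)] s(3))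
    ultimately show ?thesis
      using poly.span_diff[of "linext \<phi> s"] by fastforce
  qed
qed

text \<open>The condition \<open>P\<close> is left open for two uses: always true for generating the
  quotient, and \<open>v \<prec> w\<close> for a composition with ambiguity
  \<open>w\<close>.\<close>

lemma reduction:
  assumes f: "f \<in> cpolys X Om"
    and P: "\<And>v w. P w \<Longrightarrow> (v, w) \<in> r \<Longrightarrow> P v" "\<And>v. v \<in> Poly_Mapping.keys f \<Longrightarrow> P v"
  shows "\<exists>c. Poly_Mapping.keys c \<subseteq> Irr X Om r S \<and> f - c \<in> poly.span (gens P)"
proof -
  let ?G = "gens P \<union> word_poly ` Irr X Om r S"
  have "word_poly ` Poly_Mapping.keys f \<subseteq> poly.span ?G"
  proof (rule image_subsetI)
    fix w assume w: "w \<in> Poly_Mapping.keys f"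
    have "gens (\<lambda>v. (v, w) \<in> r) \<union> word_poly ` Irr X Om r S \<subseteq> ?G"
      using P w by (intro Un_mono gens_mono order_refl) blast
    moreover have "w \<in> cwords X Om"
      using f w by (auto simp: cpolys_iff)
    ultimately show "word_poly w \<in> poly.span ?G"
      using word_poly_reduction poly.span_mono by blast
  qed
  then have "f \<in> poly.span ?G"
    using word_poly_span[of f] poly.span_minimal[OF _ poly.subspace_span] by blast
  then obtain g c where f_eq: "f = g + c" and g: "g \<in> poly.span (gens P)"
    and c: "c \<in> poly.span (word_poly ` Irr X Om r S)"
    unfolding poly.span_Un by blast
  have "Poly_Mapping.keys c \<subseteq> Irr X Om r S"
    by (rule keys_span_subset[OF c]) auto
  then show ?thesis
    using g f_eq by (intro exI[of _ c]) simp
qed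

text \<open>Either kind of composition is a difference of two instances with leading word
  \<open>w\<close>; both are monic, so \<open>w\<close> cancels.\<close>

lemma composition_in_ideal:
  assumes f: "f \<in> S" and g: "g \<in> S" and "is_composition X Om r f g w h"
  shows "h \<in> ideal_span \<and> (\<forall>v\<in>Poly_Mapping.keys h. v \<prec> w)"
proof -
  have "\<exists>\<phi>\<in>contexts X Om. \<exists>\<psi>\<in>contexts X Om. w = \<phi> (lead f) \<and> w = \<psi> (lead g) \<and>
      h = linext \<phi> f - linext \<psi> g"
    using assms(3)
  proof cases
    case (intersection a b)
    then show ?thesis
      by (intro bexI[of _ "(+) a"] bexI[of _ "(+) b"] context_times_word) (simp_all add: single_mult_eq)
  next
    case (inclusion u)
    then show ?thesis
      using star_word_context(1)[OF inclusion(2)] star_word_context(2)[OF inclusion(2), of g]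
      by (intro bexI[of _ "\<lambda>w. w"] bexI[of _ "plug_word u"] context_id) simp_all
  qed
  then obtain \<phi> \<psi> where \<phi>: "\<phi> \<in> contexts X Om" "w = \<phi> (lead f)" and \<psi>: "\<psi> \<in> contexts X Om" "w = \<psi> (lead g)"
    and h: "h = linext \<phi> f - linext \<psi> g"
    by blast
  have "h \<in> ideal_span"
    unfolding h by (intro poly.span_diff poly.span_base gensI \<phi> \<psi> f g TrueI)
  moreover have "v \<prec> w" if v: "v \<in> Poly_Mapping.keys h" for v
  proof -
    have "v \<in> Poly_Mapping.keys (linext \<phi> f) \<or> v \<in> Poly_Mapping.keys (linext \<psi> g)"
      using v by (auto simp: h in_keys_iff lookup_minus)
    then have "(v, w) \<in> r"
      using keys_linext_S[OF \<phi>(1) f] keys_linext_S[OF \<psi>(1) g] \<phi>(2) \<psi>(2) by auto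
    moreover have "v \<noteq> w"
      using v lookup_linext_S[OF \<phi>(1) f] lookup_linext_S[OF \<psi>(1) g] \<phi>(2) \<psi>(2)
      by (auto simp: h in_keys_iff lookup_minus)
    ultimately show ?thesis by simp
  qed
  ultimately show ?thesis by blast
qed

text \<open>The span of the irreducible words meets the ideal only in zero; this is linear
  independence of their images in the quotient.\<close>

definition Irr_independent :: bool where
  "Irr_independent \<longleftrightarrow> (\<forall>c\<in>ideal_span. Poly_Mapping.keys c \<subseteq> Irr X Om r S \<longrightarrow> c = 0)"

text \<open>Reducing a composition with instances below \<open>w\<close> leaves a combination of
  irreducible words that still lies in the ideal, hence is zero.\<close>

lemma Irr_independent_imp_gsb:
  assumes Irr_independent
  shows "groebner_shirshov_basis X Om r S"
  unfolding groebner_shirshov_basis_def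
proof (intro ballI allI impI)
  fix f g w h assume fg: "f \<in> S" "g \<in> S" "is_composition X Om r f g w h"
  note h = composition_in_ideal[OF fg]
  have "h \<in> cpolys X Om"
    using h ideal_span_cpolys by blast
  moreover have "u \<prec> w" if "v \<prec> w" "(u, v) \<in> r" for u v
    using r_le_less_trans[OF that(2,1)] .
  ultimately obtain c where c: "Poly_Mapping.keys c \<subseteq> Irr X Om r S"
    "h - c \<in> poly.span (gens (\<lambda>v. v \<prec> w))"
    using reduction[of h "\<lambda>v. v \<prec> w"] h by blast
  have "h - (h - c) \<in> ideal_span"
    using h c(2) span_gens_subset_ideal by (blast intro: poly.span_diff)
  then have "c = 0"
    using assms c(1) unfolding Irr_independent_def by simp
  then show "trivial_mod X Om r S w h"
    using c(2) by (simp add: trivial_mod_iff)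
qed

text \<open>The leading word of a nonzero combination of irreducible words is itself
  irreducible.\<close>

lemma lead_reducible_imp_Irr_independent:
  assumes "\<forall>f\<in>ideal_span. f \<noteq> 0 \<longrightarrow> reducible (lead f)"
  shows Irr_independent
  unfolding Irr_independent_def
proof (intro ballI impI, rule ccontr)
  fix c assume c: "c \<in> ideal_span" "Poly_Mapping.keys c \<subseteq> Irr X Om r S" "c \<noteq> 0"
  then have "lead c \<in> Poly_Mapping.keys c"
    using ideal_span_cpolys by (intro lead_word_max) auto
  then show False
    using assms c by (auto simp: Irr_iff)
qed

text \<open>The three implications used form a cycle, so both equivalences follow.\<close>

lemma gsb_iff_lead_reducible:
  "groebner_shirshov_basis X Om r S \<longleftrightarrow> (\<forall>f\<in>ideal_span. f \<noteq> 0 \<longrightarrow> reducible (lead f))"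
  and gsb_iff_Irr_independent: "groebner_shirshov_basis X Om r S \<longleftrightarrow> Irr_independent"
  using gsb_lead_reducible lead_reducible_imp_Irr_independent Irr_independent_imp_gsb by blast+

end


section \<open>The quotient algebra\<close>

context monic_polys
begin

abbreviation cls :: "('x, 'o, 'k) cpoly \<Rightarrow> ('x, 'o, 'k) cpoly set" where
  "cls \<equiv> residue_class X Om S"

abbreviation Q :: "('k, ('x, 'o, 'k) cpoly set) module" where
  "Q \<equiv> quotient_algebra X Om S"

lemma in_cls_iff: "g \<in> cls f \<longleftrightarrow> g \<in> cpolys X Om \<and> g - f \<in> ideal_span"
  by (simp add: residue_class_def Id_gen_eq)

lemma in_cls_self: "f \<in> cpolys X Om \<Longrightarrow> f \<in> cls f"
  by (simp add: in_cls_iff poly.span_zero)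

lemma cls_eqI:
  assumes "f - g \<in> ideal_span"
  shows "cls f = cls g"
proof -
  have "h - f \<in> ideal_span \<longleftrightarrow> h - g \<in> ideal_span" for h
    using poly.span_add_eq2[OF assms, of "h - f"] by simp
  then show ?thesis
    by (auto simp: in_cls_iff)
qed

lemma cls_eq_iff: "f \<in> cpolys X Om \<Longrightarrow> cls f = cls g \<longleftrightarrow> f - g \<in> ideal_span"
  using cls_eqI in_cls_self in_cls_iff by blast

lemma carrier_Q: "carrier Q = cls ` cpolys X Om"
  and zero_Q: "\<zero>\<^bsub>Q\<^esub> = cls 0"
  by (simp_all add: quotient_algebra_def)

text \<open>The record takes a union over all representatives. Every choice gives the same class and
  the classes are nonempty, so the union collapses to it.\<close>

lemma add_cls:
  assumes "f \<in> cpolys X Om" "g \<in> cpolys X Om"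
  shows "cls f \<oplus>\<^bsub>Q\<^esub> cls g = cls (f + g)"
proof -
  have step: "cls (f' + g') = cls (f + g)" if "f' \<in> cls f" "g' \<in> cls g" for f' g'
  proof (rule cls_eqI)
    have "(f' - f) + (g' - g) \<in> ideal_span"
      using that by (intro poly.span_add) (simp_all add: in_cls_iff)
    then show "f' + g' - (f + g) \<in> ideal_span"
      by (simp add: algebra_simps)
  qed
  have "cls f \<noteq> {}" "cls g \<noteq> {}"
    using assms in_cls_self by blast+
  then have "(\<Union>f'\<in>cls f. \<Union>g'\<in>cls g. cls (f' + g')) = cls (f + g)"
    by (intro SUP_eq_const step)
  then show ?thesis
    by (simp add: quotient_algebra_def)
qed

lemma smult_cls:
  assumes "f \<in> cpolys X Om"
  shows "c \<odot>\<^bsub>Q\<^esub> cls f = cls (scale c f)"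
proof -
  have step: "cls (scale c f') = cls (scale c f)" if "f' \<in> cls f" for f'
  proof (rule cls_eqI)
    have "scale c (f' - f) \<in> ideal_span"
      using that by (intro poly.span_scale) (simp add: in_cls_iff)
    then show "scale c f' - scale c f \<in> ideal_span"
      by (simp add: poly.scale_right_diff_distrib)
  qed
  have "cls f \<noteq> {}"
    using assms in_cls_self by blast
  then have "(\<Union>f'\<in>cls f. cls (scale c f')) = cls (scale c f)"
    by (intro SUP_eq_const step)
  then show ?thesis
    by (simp add: quotient_algebra_def)
qed

text \<open>Provides the rules for \<open>finsum\<close> needed to evaluate
  \<open>lin_comb\<close>.\<close>

lemma abelian_monoid_Q: "abelian_monoid Q"
  by (rule abelian_monoidI)
    (auto simp: carrier_Q zero_Q add_cls poly.subspace_add[OF subspace_cpolys]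
      poly.subspace_0[OF subspace_cpolys] ac_simps)

text \<open>A finitely supported coefficient family on words is itself a polynomial, and passing to
  residue classes is linear.\<close>

lemma lin_comb_Q:
  assumes "Poly_Mapping.keys c \<subseteq> cwords X Om"
  shows "lin_comb Q (\<lambda>w. cls (word_poly w)) c = cls c"
proof -
  interpret Q: abelian_monoid Q by (rule abelian_monoid_Q)
  let ?t = "\<lambda>w. Poly_Mapping.single w (Poly_Mapping.lookup c w)"
  have single: "Poly_Mapping.single w d \<in> cpolys X Om" if "w \<in> cwords X Om" for w and d :: 'k
    using that by (auto simp: cpolys_iff)
  have "(\<Oplus>\<^bsub>Q\<^esub>w\<in>A. Poly_Mapping.lookup c w \<odot>\<^bsub>Q\<^esub> cls (word_poly w)) = cls (sum ?t A)"
    if "finite A" "A \<subseteq> cwords X Om" for A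
    using that
  proof (induction A)
    case empty
    show ?case by (simp add: zero_Q)
  next
    case (insert w A)
    have summand: "Poly_Mapping.lookup c v \<odot>\<^bsub>Q\<^esub> cls (word_poly v) = cls (?t v)" if "v \<in> cwords X Om" for v
      using single[OF that] by (simp add: smult_cls scale_single)
    then have "Poly_Mapping.lookup c v \<odot>\<^bsub>Q\<^esub> cls (word_poly v) \<in> carrier Q" if "v \<in> insert w A" for v
      using insert.prems that single[of v] by (auto simp: carrier_Q)
    then have "(\<Oplus>\<^bsub>Q\<^esub>w\<in>insert w A. Poly_Mapping.lookup c w \<odot>\<^bsub>Q\<^esub> cls (word_poly w)) =
        Poly_Mapping.lookup c w \<odot>\<^bsub>Q\<^esub> cls (word_poly w) \<oplus>\<^bsub>Q\<^esub>
        (\<Oplus>\<^bsub>Q\<^esub>w\<in>A. Poly_Mapping.lookup c w \<odot>\<^bsub>Q\<^esub> cls (word_poly w))"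
      using insert.hyps by (intro Q.finsum_insert) auto
    also have "\<dots> = cls (?t w) \<oplus>\<^bsub>Q\<^esub> cls (sum ?t A)"
      using insert summand[of w] by simp
    also have "\<dots> = cls (?t w + sum ?t A)"
      using insert.prems by (intro add_cls poly.subspace_sum[OF subspace_cpolys] single) auto
    finally show ?case
      using insert by simp
  qed
  from this[of "Poly_Mapping.keys c"] assms show ?thesis
    unfolding lin_comb_def by (simp flip: poly_expansion[OF finite_keys subset_refl])
qed

text \<open>By \<open>reduction\<close> the irreducible words generate the quotient for every
  \<open>S\<close> as in the locale, so only linear independence distinguishes the bases.\<close>

lemma is_module_basis_iff:
  "is_module_basis Q (Irr X Om r S) (\<lambda>w. cls (word_poly w)) \<longleftrightarrow> Irr_independent"
proof -
  have Irr: "Irr X Om r S \<subseteq> cwords X Om"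
    by (auto simp: Irr_def)
  then have lin_comb: "lin_comb Q (\<lambda>w. cls (word_poly w)) c = cls c"
    if "Poly_Mapping.keys c \<subseteq> Irr X Om r S" for c
    using that by (intro lin_comb_Q) blast
  have image: "(\<lambda>w. cls (word_poly w)) ` Irr X Om r S \<subseteq> carrier Q"
    using Irr unfolding carrier_Q by (auto simp: cpolys_iff)
  have generating: "\<exists>c. Poly_Mapping.keys c \<subseteq> Irr X Om r S \<and> m = lin_comb Q (\<lambda>w. cls (word_poly w)) c"
    if m: "m \<in> carrier Q" for m
  proof -
    obtain f where f: "f \<in> cpolys X Om" "m = cls f"
      using m by (auto simp: carrier_Q)
    obtain c where c: "Poly_Mapping.keys c \<subseteq> Irr X Om r S" "f - c \<in> ideal_span"
      using reduction[OF f(1), of "\<lambda>_. True"] by blast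
    then show ?thesis
      using cls_eqI f(2) lin_comb by (intro exI[of _ c]) simp
  qed
  have zero: "(lin_comb Q (\<lambda>w. cls (word_poly w)) c = \<zero>\<^bsub>Q\<^esub>) \<longleftrightarrow> c \<in> ideal_span"
    if "Poly_Mapping.keys c \<subseteq> Irr X Om r S" for c
    using that Irr cls_eq_iff[of c 0] by (simp add: lin_comb zero_Q cpolys_iff subset_trans[OF _ Irr])
  have "is_module_basis Q (Irr X Om r S) (\<lambda>w. cls (word_poly w)) \<longleftrightarrow>
      (\<forall>c. Poly_Mapping.keys c \<subseteq> Irr X Om r S \<and> lin_comb Q (\<lambda>w. cls (word_poly w)) c = \<zero>\<^bsub>Q\<^esub> \<longrightarrow> c = 0)"
    unfolding is_module_basis_def using image generating by simp
  then show ?thesis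
    unfolding Irr_independent_def using zero by auto
qed

end

theorem theorem3p2:
  fixes X :: "'x set"
    and Om :: "nat \<Rightarrow> 'o set"
    and r :: "(('x, 'o) cword \<times> ('x, 'o) cword) set"
    and S :: "('x, 'o, 'k::comm_ring_1) cpoly set"
  assumes "monomial_order X Om r"
    and "S \<subseteq> cpolys X Om"
    and "\<forall>s\<in>S. monic r s"
  shows "(groebner_shirshov_basis X Om r S \<longleftrightarrow>
            (\<forall>f\<in>Id_gen X Om S. f \<noteq> 0 \<longrightarrow>
               (\<exists>u\<in>star_words X Om. \<exists>s\<in>S. lead_word r f = plug_word u (lead_word r s)))) \<and>
         (groebner_shirshov_basis X Om r S \<longleftrightarrow>
            is_module_basis (quotient_algebra X Om S) (Irr X Om r S)
              (\<lambda>w. residue_class X Om S (word_poly w)))"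
proof -
  interpret monic_polys X Om r S
    using assms by unfold_locales
  show ?thesis
    using gsb_iff_lead_reducible gsb_iff_Irr_independent
    by (simp only: is_module_basis_iff Id_gen_eq reducible_iff)
qed

end
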